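(* For all $\lambda\in\mathbb C$ and all $w\in\mathbb C$ with $\mathrm{Re}\,w>0$, the function $S_\lambda$ (the standard solution of the Hermite equation with behavior $w^{-\lambda-\frac12}$ as $w\to+\infty$) satisfies $$\partial_wS_\lambda(w)=-\big(\tfrac12+\lambda\big)S_{\lambda+1}(w),$$ $$(\partial_w-2w)S_\lambda(w)=-2S_{\lambda-1}(w),$$ $$\Big(w\partial_w+\tfrac12+\lambda\Big)S_\lambda(w)=\tfrac12\big(\tfrac12+\lambda\big)\big(\tfrac32+\lambda\big)S_{\lambda+2}(w),$$ $$\Big(w\partial_w+\tfrac12-\lambda-2w^2\Big)S_\lambda(w)=-2S_{\lambda-2}(w).$$
   Context: The ${}_2F_0$ function is defined for $z\in\mathbb C\setminus[0,+\infty[$ by $F(a,b;-;z):=\lim_{c\to\infty}F(a,b;c;cz)$, where $F(a,b;c;\cdot)$ is the Gauss hypergeometric function on $\mathbb C\setminus[1,\infty[$ and $c\to\infty$ with $|\arg c-\pi|<\pi-\epsilon$, $\epsilon>0$. It has the asymptotic expansion $F(a,b;-;z)\sim\sum_{n\ge0}\frac{(a)_n(b)_n}{n!}z^n$ as $z\to0$, $|\arg z-\pi|<\pi-\epsilon$. For $\lambda\in\mathbb C$ and $\mathrm{Re}\,w>0$, with the principal branch of the power, $$S_\lambda(w):=w^{-\lambda-\frac12}\,F\Big(\tfrac{\lambda}{2}+\tfrac14,\ \tfrac{\lambda}{2}+\tfrac34;\ -;\ -w^{-2}\Big).$$ It is a solution of the Hermite equation $(\partial_w^2-2w\partial_w-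2\lambda-1)S=0$.
   Formalization: In the definition of the 2F0 function, c tends to infinity with |arg c| < π/2 − ε and |arg c + arg(−z)| < π − ε instead of |arg c − π| < π − ε, since in the latter sector the limit does not exist (poles at c = −n; cz on the cut for z < 0, c < 0). *)

theory Defs
  imports "HOL-Complex_Analysis.Complex_Analysis"
begin

definition slit_plane :: "complex set" where
  "slit_plane = - {of_real x | x::real. x \<ge> 1}"

text \<open>
  The Gauss hypergeometric function: the analytic continuation to \<open>slit_plane\<close> of the
  hypergeometric series. As \<open>slit_plane\<close> is connected, at most one value qualifies for each
  \<open>z\<close> in it. Nothing is claimed for \<open>z\<close> on the cut, or for \<open>c\<close> in \<open>\<int>\<^sub>\<le>\<^sub>0\<close>.
\<close>

definition hyp2F1 :: "complex \<Rightarrow> complex \<Rightarrow> complex \<Rightarrow> complex \<Rightarrow> complex" where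
  "hyp2F1 a b c z =
     (THE y. \<exists>f. f holomorphic_on slit_plane \<and>
                 (\<forall>u\<in>ball 0 1. f u = eval_fps (fps_hypergeo [a, b] [c] 1) u) \<and>
                 y = f z)"

lemma eval_fps_hypergeo_2_1:
  "eval_fps (fps_hypergeo [a, b] [c] 1) z =
     (\<Sum>n. pochhammer a n * pochhammer b n / (pochhammer c n * fact n) * (z :: complex) ^ n)"
  by (simp add: eval_fps_def)

text \<open>
  The sector, around the positive axis, in which \<open>c\<close> tends to infinity. For a limit of
  \<open>F(a,b;c;c z)\<close> to exist, \<open>c\<close> must stay away from the negative real axis, as \<open>F\<close> has poles at
  \<open>c = 0, -1, -2, \<dots>\<close>; so the condition \<open>\<bar>arg c - \<pi>\<bar> < \<pi> - \<epsilon>\<close> cannot be meant literally. The second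
  condition keeps \<open>c z\<close> away from the cut, \<open>Arg c + Arg (- z)\<close> being a value of the argument of \<open>- c z\<close>.
  It is imposed on the sum of the arguments and not only on \<open>Arg (- c * z)\<close>: directions of \<open>c\<close>
  that can be reached from the positive axis only by letting \<open>c z\<close> cross the cut lead to a
  different limit. The limit does not depend on the opening of the sector.
\<close>

definition hyp2F0_sector :: "complex \<Rightarrow> real \<Rightarrow> complex set" where
  "hyp2F0_sector z \<epsilon> =
     {c. \<bar>Arg c\<bar> < pi / 2 - \<epsilon> \<and> \<bar>Arg c + Arg (- z)\<bar> < pi - \<epsilon>}"

text \<open>Intended for \<open>z\<close> outside \<open>[0, \<infinity>)\<close>: the sector then contains the positive axis for small \<open>\<epsilon>\<close>.\<close>

definition hyp2F0 :: "complex \<Rightarrow> complex \<Rightarrow> complex \<Rightarrow> complex" where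
  "hyp2F0 a b z =
     (THE L. \<forall>\<epsilon>>0. ((\<lambda>c. hyp2F1 a b c (c * z)) \<longlongrightarrow> L)
                       (inf at_infinity (principal (hyp2F0_sector z \<epsilon>))))"

definition hermite_S :: "complex \<Rightarrow> complex \<Rightarrow> complex" where
  "hermite_S l w =
     w powr (- l - 1 / 2) * hyp2F0 (l / 2 + 1 / 4) (l / 2 + 3 / 4) (- (w powi (- 2)))"

end

theory Submission
  imports Defs
begin

text \<open>
  For \<open>Re a \<ge> 0\<close> and \<open>Re b \<ge> 1\<close>, Euler's integral gives the continuation of \<open>F(a,b;c;\<cdot>)\<close> to the slit
  plane, and substituting \<open>t = s / |c|\<close> in it shows that \<open>F(a,b;c;c z)\<close> tends to
  \<open>\<integral>\<^sub>0\<^sup>\<infinity> s\<^sup>b\<^sup>-\<^sup>1 e\<^sup>-\<^sup>s (1 - z s)\<^sup>-\<^sup>a ds / \<Gamma>(b)\<close>; for complex \<open>c\<close> the limit first appears along the ray of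
  direction \<open>Arg c\<close>, which is rotated back to the real axis. The contiguous relation
  between \<open>b - 1\<close>, \<open>b\<close> and \<open>b + 1\<close> carries continuation, limit and derivative to all \<open>b\<close>, and then, by the
  symmetry in \<open>a\<close> and \<open>b\<close>, to all \<open>a\<close>.

  Differentiating the integral yields \<open>(z \<partial> + a) F(a,b) = a F(a+1,b)\<close>. With the contiguous relation
  \<open>(a - b) F(a,b) = a F(a+1,b) - b F(a,b+1)\<close> this gives the formula for the derivative of \<open>S\<^sub>\<lambda>\<close>, and the
  contiguous relations alone give a three-term recurrence for \<open>S\<^sub>\<lambda>\<close>; the remaining identities are
  linear combinations of these two.
\<close>

section \<open>Integrals depending on a complex parameter\<close>

text \<open>The formal series of the \<open>2F0\<close> function diverges, so no identity can be
  read off its coefficients. Algebraic relations are proved for \<open>2F1\<close>, where comparison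
  of coefficients and the identity theorem are available, and survive the limit in c; a pointwise
  limit does not carry derivatives along, so these come from the integral. The restrictions on the
  parameters buy domination: with \<open>Re a \<ge> 0\<close> a lower bound of |1 - z s| bounds its
  power -a from above, and \<open>Re b \<ge> 1\<close> together with
  \<open>Re (c - b) \<ge> 1\<close> bounds the beta weight by 1. The Beta integral that normalises
  Euler's formula is never evaluated. The case a = 0 of the same limit shows that c^b times it tends
  to \<open>Gamma b\<close>; this gives the denominator of the limit and also shows that the
  normalisation is nonzero for large c. Both functions are definite descriptions, so that a relation
  between values means something only where the continuation, or the limit, is known to exist.
  Existence is therefore carried through the contiguous relations together with the values.\<close>

lemma has_field_derivative_integral_dominated:
  fixes f :: "complex \<Rightarrow> real \<Rightarrow> complex"
  assumes r: "r > 0"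
    and int: "\<And>u. u \<in> ball z r \<Longrightarrow> f u integrable_on S"
    and der: "\<And>u t. u \<in> ball z r \<Longrightarrow> t \<in> S \<Longrightarrow> ((\<lambda>u. f u t) has_field_derivative f' u t) (at u)"
    and le: "\<And>u t. u \<in> ball z r \<Longrightarrow> t \<in> S \<Longrightarrow> norm (f' u t) \<le> h t"
    and h: "h integrable_on S"
  shows "((\<lambda>u. integral S (f u)) has_field_derivative integral S (f' z)) (at z)"
  unfolding has_field_derivative_iff
proof (rule tendsto_at_iff_sequentially[THEN iffD2], intro allI impI)
  fix X :: "nat \<Rightarrow> complex"
  assume X: "\<forall>i. X i \<in> UNIV - {z}" "X \<longlonglongrightarrow> z"
  obtain N where N: "\<And>n. n \<ge> N \<Longrightarrow> X n \<in> ball z r"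
    using tendstoD[OF X(2) r] by (auto simp: eventually_sequentially dist_commute)
  \<comment> \<open>Dropping the first N terms puts the whole sequence into the ball, so that the
    domination holds for every index and not only eventually.\<close>
  define Y where "Y k = X (k + N)" for k
  have Yb: "Y k \<in> ball z r" "Y k \<noteq> z" for k using N X by (auto simp: Y_def)
  have Ylim: "Y \<longlonglongrightarrow> z" unfolding Y_def using X(2) by (rule LIMSEQ_ignore_initial_segment)
  have zb: "z \<in> ball z r" using r by simp
  have "(\<lambda>k. integral S (\<lambda>t. (f (Y k) t - f z t) / (Y k - z))) \<longlonglongrightarrow> integral S (f' z)"
  proof (rule dominated_convergence(2)[where h = h])
    show "(\<lambda>t. (f (Y k) t - f z t) / (Y k - z)) integrable_on S" for k
      unfolding divide_inverse
      by (intro integrable_on_mult_left integrable_diff int Yb zb)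
    show "h integrable_on S" by fact
    show "norm ((f (Y k) t - f z t) / (Y k - z)) \<le> h t" if t: "t \<in> S" for k t
    proof -
      have "norm (f (Y k) t - f z t) \<le> h t * norm (Y k - z)"
        by (rule field_differentiable_bound[where S = "ball z r" and f' = "\<lambda>u. f' u t"])
           (use t der le Yb zb in \<open>auto intro: has_field_derivative_at_within\<close>)
      then show ?thesis using Yb(2)[of k] by (simp add: norm_divide field_simps)
    qed
    show "(\<lambda>k. (f (Y k) t - f z t) / (Y k - z)) \<longlonglongrightarrow> f' z t" if t: "t \<in> S" for t
      using der[OF zb t] Yb(2) Ylim unfolding has_field_derivative_iff
      by (auto simp: tendsto_at_iff_sequentially o_def)
  qed
  also have "(\<lambda>k. integral S (\<lambda>t. (f (Y k) t - f z t) / (Y k - z)))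
      = (\<lambda>k. (integral S (f (Y k)) - integral S (f z)) / (Y k - z))"
    by (rule ext) (simp add: divide_inverse integral_diff[OF int[OF Yb(1)] int[OF zb]])
  finally have "(\<lambda>k. ((\<lambda>u. (integral S (f u) - integral S (f z)) / (u - z)) \<circ> X) (k + N))
      \<longlonglongrightarrow> integral S (f' z)"
    by (simp add: Y_def o_def)
  then show "((\<lambda>u. (integral S (f u) - integral S (f z)) / (u - z)) \<circ> X)
      \<longlonglongrightarrow> integral S (f' z)"
    by (rule LIMSEQ_offset)
qed

lemma continuous_dominated_integrable_on:
  fixes f :: "real \<Rightarrow> 'b::euclidean_space"
  assumes "continuous_on S f" "open S" "g integrable_on S" "\<And>x. x \<in> S \<Longrightarrow> norm (f x) \<le> g x"
  shows "f integrable_on S"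
proof (rule measurable_bounded_by_integrable_imp_integrable[OF _ assms(3,4)])
  show S: "S \<in> sets lebesgue"
    using borel_open[OF assms(2)] by (metis sets_completionI_sets sets_lborel)
  show "f \<in> borel_measurable (lebesgue_on S)"
    by (rule continuous_imp_measurable_on_sets_lebesgue[OF assms(1) S])
qed

text \<open>The norm is |u|^(-Re a) exp (Im a * Arg u). The principal argument is bounded by pi, and
  \<open>Re a \<ge> 0\<close> turns a lower bound of |u| into an upper bound of the power.\<close>

lemma norm_powr_minus_le:
  fixes u a :: complex
  assumes "0 < \<kappa>" "\<kappa> \<le> norm u" "Re a \<ge> 0"
  shows "norm (u powr (- a)) \<le> \<kappa> powr (- Re a) * exp (pi * \<bar>Im a\<bar>)"
proof -
  have "Im a * Arg u \<le> \<bar>Im a\<bar> * \<bar>Arg u\<bar>" by (metis abs_ge_self abs_mult)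
  also have "\<dots> \<le> \<bar>Im a\<bar> * pi"
    using mpi_less_Arg[of u] Arg_le_pi[of u] by (intro mult_left_mono) auto
  finally have "exp (Im a * Arg u) \<le> exp (pi * \<bar>Im a\<bar>)" by (simp add: mult.commute)
  moreover have "norm u powr (- Re a) \<le> \<kappa> powr (- Re a)"
    using assms by (intro powr_mono2') auto
  ultimately show ?thesis
    unfolding norm_powr_complex by (auto intro!: mult_mono)
qed

text \<open>Completing the square: with x = |p| s the squared norm is at least (x - cos e)^2 + (sin
  e)^2. The bound is uniform in s and in all p of the sector, which every dominating function for
  the Laplace kernel rests on.\<close>

lemma sin_le_norm_1_plus:
  fixes p :: complex
  assumes "\<bar>Arg p\<bar> \<le> pi - e" "0 < e" "e \<le> pi / 2" "s \<ge> 0"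
  shows "sin e \<le> norm (1 + p * of_real s)"
proof -
  define x where "x = norm p * s"
  have x: "x \<ge> 0" using assms by (simp add: x_def)
  have p: "p = of_real (norm p) * cis (Arg p)"
    by (metis rcis_cmod_Arg rcis_def)
  have "cos (Arg p) = cos \<bar>Arg p\<bar>" by simp
  also have "\<dots> \<ge> cos (pi - e)"
    using assms by (intro cos_monotone_0_pi_le) auto
  finally have c: "cos (Arg p) \<ge> - cos e" by simp
  have ps: "p * of_real s = of_real x * cis (Arg p)"
    by (subst p) (simp add: x_def)
  have "(norm (1 + p * of_real s))\<^sup>2 = (1 + x * cos (Arg p))\<^sup>2 + (x * sin (Arg p))\<^sup>2"
    unfolding ps cmod_power2 by simp
  also have "\<dots> = 1 + 2 * x * cos (Arg p) + x\<^sup>2 * ((sin (Arg p))\<^sup>2 + (cos (Arg p))\<^sup>2)"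
    by algebra
  also have "\<dots> \<ge> 1 + 2 * x * (- cos e) + x\<^sup>2"
    using mult_left_mono[OF c x] by (simp add: algebra_simps)
  also have "1 + 2 * x * (- cos e) + x\<^sup>2 = (x - cos e)\<^sup>2 + (sin e)\<^sup>2"
    unfolding sin_squared_eq by algebra
  finally have "(sin e)\<^sup>2 \<le> (norm (1 + p * of_real s))\<^sup>2"
    by (smt (verit) zero_le_power2)
  then show ?thesis by (rule power2_le_imp_le) simp
qed

lemma powr_exp_integrable:
  fixes x d :: real
  assumes "x > 0" "d > 0"
  shows "(\<lambda>s. s powr (x - 1) * exp (- (d * s))) integrable_on {0<..}"
proof -
  have "(\<lambda>s. norm (complex_of_real s powr (of_real x - 1) / of_real (exp (d * s)))) integrable_on {0<..}"
    using absolutely_integrable_Gamma_integral[of "of_real x" d] assms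
    by (auto simp: absolutely_integrable_on_def)
  then show ?thesis
    by (rule integrable_eq) (simp add: norm_divide norm_powr_real_powr exp_minus divide_inverse norm_mult norm_inverse
        del: of_real_exp)
qed

section \<open>Laplace integrals: domination, dependence on the parameters, rotation of the
  ray\<close>

text \<open>Replacing s by a multiple of s multiplies q and p by the same factor, so q is kept as a
  parameter although only q = 1 enters the final formula. For positive p,
  \<open>laplace_int a b 1 p / Gamma b\<close> is p^(-b) U(b, b - a + 1, 1/p) with the Tricomi
  function U.\<close>

definition laplace_kernel :: "complex \<Rightarrow> complex \<Rightarrow> complex \<Rightarrow> complex \<Rightarrow> real \<Rightarrow> complex" where
  "laplace_kernel a b q p s =
     of_real s powr (b - 1) * exp (- (q * of_real s)) * (1 + p * of_real s) powr (- a)"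

definition laplace_int :: "complex \<Rightarrow> complex \<Rightarrow> complex \<Rightarrow> complex \<Rightarrow> complex" where
  "laplace_int a b q p = integral {0<..} (laplace_kernel a b q p)"

lemma nonpos_Reals_iff_Arg: "p \<in> \<real>\<^sub>\<le>\<^sub>0 \<longleftrightarrow> p = 0 \<or> Arg p = pi"
  by (auto simp: complex_nonpos_Reals_iff Arg_eq_pi complex_eq_iff less_le)

lemma one_plus_notin_nonpos_Reals:
  assumes "p \<notin> \<real>\<^sub>\<le>\<^sub>0" "s \<ge> 0"
  shows "1 + p * complex_of_real s \<notin> \<real>\<^sub>\<le>\<^sub>0"
proof (cases "Im p = 0")
  case True
  then have "Re p > 0" using assms by (auto simp: complex_nonpos_Reals_iff)
  then have "Re p * s \<ge> 0" using assms by simp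
  then show ?thesis by (auto simp: complex_nonpos_Reals_iff)
next
  case False
  then show ?thesis by (cases "s = 0") (auto simp: complex_nonpos_Reals_iff)
qed

text \<open>The bound depends on p and q only through the margins e and d, so one integrable
  function dominates the kernel for a whole neighbourhood of parameters.\<close>

lemma norm_laplace_kernel_le:
  assumes "Re a \<ge> 0" "0 < e" "e \<le> pi / 2" "\<bar>Arg p\<bar> \<le> pi - e" "d \<le> Re q" "s > 0"
  shows "norm (laplace_kernel a b q p s)
    \<le> sin e powr (- Re a) * exp (pi * \<bar>Im a\<bar>) * (s powr (Re b - 1) * exp (- (d * s)))"
proof -
  have "sin e > 0" using assms by (intro sin_gt_zero) auto
  then have "norm ((1 + p * of_real s) powr (- a)) \<le> sin e powr (- Re a) * exp (pi * \<bar>Im a\<bar>)"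
    using sin_le_norm_1_plus[of p e s] assms by (intro norm_powr_minus_le) auto
  moreover have "norm (of_real s powr (b - 1)) = s powr (Re b - 1)"
    using assms by (simp add: norm_powr_real_powr)
  moreover have "norm (exp (- (q * of_real s))) \<le> exp (- (d * s))"
    using assms by simp
  ultimately have "norm (laplace_kernel a b q p s)
      \<le> s powr (Re b - 1) * exp (- (d * s)) * (sin e powr (- Re a) * exp (pi * \<bar>Im a\<bar>))"
    unfolding laplace_kernel_def norm_mult by (intro mult_mono) auto
  then show ?thesis by (simp add: mult_ac)
qed

lemma continuous_on_laplace_kernel:
  assumes "p \<notin> \<real>\<^sub>\<le>\<^sub>0"
  shows "continuous_on {0<..} (laplace_kernel a b q p)"
  unfolding laplace_kernel_def continuous_on_eq_continuous_at[OF open_greaterThan]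
  using assms one_plus_notin_nonpos_Reals[OF assms]
  by (auto intro!: continuous_intros simp: complex_nonpos_Reals_iff)

text \<open>Half of the angular distance to the negative axis: the last inequality is strict and
  hence persists near p.\<close>

lemma Arg_margin:
  assumes "p \<notin> \<real>\<^sub>\<le>\<^sub>0"
  obtains e where "0 < e" "e \<le> pi / 2" "\<bar>Arg p\<bar> < pi - e"
proof
  have "\<bar>Arg p\<bar> < pi" using assms mpi_less_Arg[of p] Arg_le_pi[of p]
    by (auto simp: nonpos_Reals_iff_Arg abs_less_iff less_le)
  then show "0 < (pi - \<bar>Arg p\<bar>) / 2" "(pi - \<bar>Arg p\<bar>) / 2 \<le> pi / 2"
    "\<bar>Arg p\<bar> < pi - (pi - \<bar>Arg p\<bar>) / 2"
    by (auto simp: field_simps)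
qed

lemma laplace_kernel_integrable:
  assumes "Re a \<ge> 0" "Re b > 0" "Re q > 0" "p \<notin> \<real>\<^sub>\<le>\<^sub>0"
  shows "laplace_kernel a b q p integrable_on {0<..}"
proof -
  obtain e where e: "0 < e" "e \<le> pi / 2" "\<bar>Arg p\<bar> < pi - e"
    using Arg_margin[OF assms(4)] .
  show ?thesis
  proof (rule continuous_dominated_integrable_on)
    show "(\<lambda>s. sin e powr (- Re a) * exp (pi * \<bar>Im a\<bar>)
        * (s powr (Re b - 1) * exp (- (Re q * s)))) integrable_on {0<..}"
      by (intro integrable_on_mult_right powr_exp_integrable assms)
  qed (use norm_laplace_kernel_le e assms continuous_on_laplace_kernel in auto)
qed

lemma laplace_kernel_shift:
  assumes "s > 0"
  shows "of_real s * laplace_kernel a b q p s = laplace_kernel a (b + 1) q p s"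
proof -
  have "of_real s powr b = complex_of_real s powr (b - 1) * of_real s"
    using assms powr_add[of "complex_of_real s" "b - 1" 1] by simp
  then show ?thesis by (simp add: laplace_kernel_def)
qed

lemma isCont_tendsto_nhds: "isCont f z \<Longrightarrow> (f \<longlongrightarrow> f z) (nhds z)"
  unfolding isCont_def by (rule tendsto_at_iff_tendsto_nhds[THEN iffD1])

text \<open>The affine form of the parameters serves two uses: both proportional to the variable,
  for rotating the ray, and first parameter fixed at 1, for differentiating in p.\<close>

lemma has_field_derivative_laplace_int:
  assumes a: "Re a \<ge> 0" and b: "Re b > 0"
    and z: "Re (\<alpha> + \<beta> * z) > 0" "\<gamma> * z \<notin> \<real>\<^sub>\<le>\<^sub>0"
  shows "((\<lambda>z. laplace_int a b (\<alpha> + \<beta> * z) (\<gamma> * z)) has_field_derivative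
     (- \<beta> * laplace_int a (b + 1) (\<alpha> + \<beta> * z) (\<gamma> * z)
      - a * \<gamma> * laplace_int (a + 1) (b + 1) (\<alpha> + \<beta> * z) (\<gamma> * z))) (at z)"
proof -
  obtain e where e: "0 < e" "e \<le> pi / 2" "\<bar>Arg (\<gamma> * z)\<bar> < pi - e"
    using Arg_margin[OF z(2)] .
  \<comment> \<open>Half of the real part, so that the real part stays above d near z and exp (- d
    s) dominates there.\<close>
  define d where "d = Re (\<alpha> + \<beta> * z) / 2"
  have d: "0 < d" "d < Re (\<alpha> + \<beta> * z)" using z by (auto simp: d_def)
  have "isCont (\<lambda>u. \<bar>Arg (\<gamma> * u)\<bar>) z"
    using continuous_at_Arg[OF z(2)]
    by (intro continuous_intros isCont_o2[where g = Arg and f = "\<lambda>u. \<gamma> * u"]) auto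
  then have "((\<lambda>u. \<bar>Arg (\<gamma> * u)\<bar>) \<longlongrightarrow> \<bar>Arg (\<gamma> * z)\<bar>) (nhds z)"
    by (rule isCont_tendsto_nhds)
  then have ev1: "eventually (\<lambda>u. \<bar>Arg (\<gamma> * u)\<bar> < pi - e) (nhds z)"
    using e by (auto dest: order_tendstoD)
  have z0: "\<gamma> * z \<noteq> 0" using z by auto
  have "isCont (\<lambda>u. \<gamma> * u) z" by (intro continuous_intros)
  then have ev3: "eventually (\<lambda>u. \<gamma> * u \<noteq> 0) (nhds z)"
    using z0 isCont_tendsto_nhds by (intro tendsto_imp_eventually_ne[of "\<lambda>u. \<gamma> * u" "\<gamma> * z"]) blast+
  have "isCont (\<lambda>u. Re (\<alpha> + \<beta> * u)) z" by simp
  then have "((\<lambda>u. Re (\<alpha> + \<beta> * u)) \<longlongrightarrow> Re (\<alpha> + \<beta> * z)) (nhds z)"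
    by (rule isCont_tendsto_nhds)
  then have ev2: "eventually (\<lambda>u. d < Re (\<alpha> + \<beta> * u)) (nhds z)"
    using d by (auto dest: order_tendstoD)
  from eventually_conj[OF ev1 eventually_conj[OF ev2 ev3]]
  obtain r where r: "r > 0" and r': "\<And>u. u \<in> ball z r \<Longrightarrow>
      \<bar>Arg (\<gamma> * u)\<bar> < pi - e \<and> d < Re (\<alpha> + \<beta> * u) \<and> \<gamma> * u \<noteq> 0"
    unfolding eventually_nhds_metric by (auto simp: dist_commute)
  have np: "\<gamma> * u \<notin> \<real>\<^sub>\<le>\<^sub>0" if "u \<in> ball z r" for u
    using r'[OF that] e by (auto simp: nonpos_Reals_iff_Arg)
  define K where "K a = sin e powr (- Re a) * exp (pi * \<bar>Im a\<bar>)" for a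
  \<comment> \<open>Both derivatives bring down a factor s, which raises b by 1; that of the power
    also raises a by 1.\<close>
  define f' where "f' u s = - \<beta> * laplace_kernel a (b + 1) (\<alpha> + \<beta> * u) (\<gamma> * u) s
      - a * \<gamma> * laplace_kernel (a + 1) (b + 1) (\<alpha> + \<beta> * u) (\<gamma> * u) s" for u s
  have "((\<lambda>u. integral {0<..} (laplace_kernel a b (\<alpha> + \<beta> * u) (\<gamma> * u)))
      has_field_derivative integral {0<..} (f' z)) (at z)"
  proof (rule has_field_derivative_integral_dominated[OF r])
    show "laplace_kernel a b (\<alpha> + \<beta> * u) (\<gamma> * u) integrable_on {0<..}" if "u \<in> ball z r" for u
      using a b d r'[OF that] np[OF that] by (intro laplace_kernel_integrable) auto
    show "(\<lambda>s. (norm \<beta> * K a + norm (a * \<gamma>) * K (a + 1)) *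
        (s powr ((Re b + 1) - 1) * exp (- (d * s)))) integrable_on {0<..}"
      using b d by (intro integrable_on_mult_right powr_exp_integrable) auto
    show "norm (f' u s) \<le> (norm \<beta> * K a + norm (a * \<gamma>) * K (a + 1)) *
        (s powr ((Re b + 1) - 1) * exp (- (d * s)))"
      if u: "u \<in> ball z r" and s: "s \<in> {0<..}" for u s
    proof -
      define w where "w = s powr ((Re b + 1) - 1) * exp (- (d * s))"
      have 1: "norm (laplace_kernel a (b + 1) (\<alpha> + \<beta> * u) (\<gamma> * u) s) \<le> K a * w"
        unfolding K_def w_def
        using norm_laplace_kernel_le[of a e "\<gamma> * u" d "\<alpha> + \<beta> * u" s "b + 1"] r'[OF u] a e s by auto
      have 2: "norm (laplace_kernel (a + 1) (b + 1) (\<alpha> + \<beta> * u) (\<gamma> * u) s) \<le> K (a + 1) * w"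
        unfolding K_def w_def
        using norm_laplace_kernel_le[of "a + 1" e "\<gamma> * u" d "\<alpha> + \<beta> * u" s "b + 1"] r'[OF u] a e s by auto
      have "norm (f' u s) \<le> norm \<beta> * norm (laplace_kernel a (b + 1) (\<alpha> + \<beta> * u) (\<gamma> * u) s)
          + norm (a * \<gamma>) * norm (laplace_kernel (a + 1) (b + 1) (\<alpha> + \<beta> * u) (\<gamma> * u) s)"
        unfolding f'_def by (rule norm_triangle_le_diff) (simp add: norm_mult)
      also have "\<dots> \<le> norm \<beta> * (K a * w) + norm (a * \<gamma>) * (K (a + 1) * w)"
        by (intro add_mono mult_left_mono 1 2) auto
      finally show ?thesis unfolding w_def by (simp add: algebra_simps)
    qed
    show "((\<lambda>u. laplace_kernel a b (\<alpha> + \<beta> * u) (\<gamma> * u) s) has_field_derivative f' u s) (at u)"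
      if u: "u \<in> ball z r" and s: "s \<in> {0<..}" for u s
    proof -
      have n: "1 + \<gamma> * u * of_real s \<notin> \<real>\<^sub>\<le>\<^sub>0"
        using one_plus_notin_nonpos_Reals[OF np[OF u], of s] s by simp
      have eq: "f' u s = of_real s powr (b - 1) *
          (- \<beta> * of_real s * exp (- ((\<alpha> + \<beta> * u) * of_real s)) * (1 + \<gamma> * u * of_real s) powr (- a)
           + exp (- ((\<alpha> + \<beta> * u) * of_real s)) *
             ((- a) * (1 + \<gamma> * u * of_real s) powr (- a - 1) * (\<gamma> * of_real s)))"
        unfolding f'_def using s
        by (simp flip: laplace_kernel_shift) (simp add: laplace_kernel_def algebra_simps minus_diff_commute)
      show ?thesis unfolding eq laplace_kernel_def mult.assoc[of "of_real s powr (b - 1)"]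
        apply (rule DERIV_cmult)
        apply (rule derivative_eq_intros refl n | simp)+
        done
    qed
  qed
  moreover have "integral {0<..} (f' z) = - \<beta> * laplace_int a (b + 1) (\<alpha> + \<beta> * z) (\<gamma> * z)
      - a * \<gamma> * laplace_int (a + 1) (b + 1) (\<alpha> + \<beta> * z) (\<gamma> * z)"
  proof -
    have i: "laplace_kernel a (b + 1) (\<alpha> + \<beta> * z) (\<gamma> * z) integrable_on {0<..}"
      "laplace_kernel (a + 1) (b + 1) (\<alpha> + \<beta> * z) (\<gamma> * z) integrable_on {0<..}"
      using a b z by (auto intro!: laplace_kernel_integrable)
    show ?thesis
      using integral_diff[OF integrable_on_mult_right[OF i(1), of "- \<beta>"]
          integrable_on_mult_right[OF i(2), of "a * \<gamma>"]]
      by (simp add: f'_def[abs_def] laplace_int_def)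
  qed
  ultimately show ?thesis by (simp add: laplace_int_def)
qed

lemma integral_scale:
  fixes f :: "real \<Rightarrow> complex"
  assumes "R > 0" "S \<in> sets lebesgue" "(\<lambda>s. R * s) ` S = T" "f absolutely_integrable_on T"
  shows "integral S (\<lambda>s. f (R * s)) = integral T f / of_real R"
proof -
  have "integral S (\<lambda>s. \<bar>R\<bar> *\<^sub>R f (R * s)) = integral T f"
    using has_absolute_integral_change_of_variables_real
      [of S "\<lambda>s. R * s" "\<lambda>_. R" f "integral T f"] assms
    by (auto intro!: derivative_eq_intros simp: inj_on_def)
  then show ?thesis using assms(1) by (simp add: field_simps scaleR_conv_of_real)
qed

lemma image_mult_greaterThan:
  assumes "R > (0::real)"
  shows "(\<lambda>s. R * s) ` {0<..} = {0<..}"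
proof (intro equalityI subsetI)
  fix x :: real assume "x \<in> {0<..}"
  then show "x \<in> (\<lambda>s. R * s) ` {0<..}"
    using assms by (intro image_eqI[of _ _ "x / R"]) auto
qed (use assms in auto)

lemma laplace_kernel_absolutely_integrable:
  assumes "Re a \<ge> 0" "Re b > 0" "Re q > 0" "p \<notin> \<real>\<^sub>\<le>\<^sub>0"
  shows "laplace_kernel a b q p absolutely_integrable_on {0<..}"
proof -
  obtain e where e: "0 < e" "e \<le> pi / 2" "\<bar>Arg p\<bar> < pi - e"
    using Arg_margin[OF assms(4)] .
  show ?thesis
  proof (rule absolutely_integrable_integrable_bound)
    show "(\<lambda>s. sin e powr (- Re a) * exp (pi * \<bar>Im a\<bar>)
        * (s powr (Re b - 1) * exp (- (Re q * s)))) integrable_on {0<..}"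
      by (intro integrable_on_mult_right powr_exp_integrable assms)
  qed (use norm_laplace_kernel_le e assms laplace_kernel_integrable in auto)
qed

text \<open>Substitution of R s for s; the Jacobian supplies the last factor of R^b. This is the
  real case of the rotation, from which the identity theorem starts.\<close>

lemma laplace_int_scale:
  assumes "Re a \<ge> 0" "Re b > 0" "p \<notin> \<real>\<^sub>\<le>\<^sub>0" "R > 0"
  shows "of_real R powr b * laplace_int a b (of_real R) (of_real R * p) = laplace_int a b 1 p"
proof -
  have "laplace_int a b 1 p / of_real R = integral {0<..} (\<lambda>s. laplace_kernel a b 1 p (R * s))"
    unfolding laplace_int_def
    by (rule integral_scale[OF _ _ image_mult_greaterThan, symmetric])
       (use assms in \<open>auto intro!: laplace_kernel_absolutely_integrable\<close>)
  also have "\<dots> = integral {0<..} (\<lambda>s. of_real R powr (b - 1) *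
      laplace_kernel a b (of_real R) (of_real R * p) s)"
    using assms
    by (intro integral_cong) (simp add: laplace_kernel_def powr_times_real mult_ac)
  also have "\<dots> = of_real R powr (b - 1) * laplace_int a b (of_real R) (of_real R * p)"
    by (simp add: laplace_int_def)
  finally show ?thesis
    using assms powr_add[of "complex_of_real R" "b - 1" 1] by (simp add: field_simps)
qed

text \<open>Principal arguments add without a jump as long as the sum stays strictly between -pi and
  pi.\<close>

lemma mult_exp_notin_nonpos_Reals:
  assumes "p \<noteq> 0" "\<bar>Im \<xi> + Arg p\<bar> < pi"
  shows "exp \<xi> * p \<notin> \<real>\<^sub>\<le>\<^sub>0" "Arg (exp \<xi> * p) = Im \<xi> + Arg p"
proof -
  have "exp \<xi> * p = exp (\<xi> + Ln p)" using assms by (simp add: exp_add)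
  moreover have "Arg (exp (\<xi> + Ln p)) = Im \<xi> + Arg p"
    using assms by (subst Arg_exp) (auto simp: Arg_eq_Im_Ln)
  ultimately show "Arg (exp \<xi> * p) = Im \<xi> + Arg p" by simp
  then show "exp \<xi> * p \<notin> \<real>\<^sub>\<le>\<^sub>0" using assms by (auto simp: nonpos_Reals_iff_Arg)
qed

text \<open>Rotation of the ray of integration, by the identity theorem: the left-hand side with
  \<open>\<i> \<theta>\<close> replaced by \<open>\<xi>\<close> is holomorphic on a strip and constant on the real axis.\<close>

lemma laplace_int_rotate:
  assumes a: "Re a \<ge> 0" and b: "Re b > 0" and p: "p \<notin> \<real>\<^sub>\<le>\<^sub>0"
    and \<theta>: "\<bar>\<theta>\<bar> < pi / 2" "\<bar>\<theta> + Arg p\<bar> < pi"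
  shows "exp (\<i> * of_real \<theta> * b) * laplace_int a b (exp (\<i> * of_real \<theta>)) (exp (\<i> * of_real \<theta>) * p)
    = laplace_int a b 1 p"
proof -
  \<comment> \<open>On D the exponential has positive real part, so the integral converges, and its
    product with p avoids the cut. D is an intersection of half-planes, hence connected, and
    contains the real axis because |Arg p| < pi.\<close>
  define D where "D = {\<xi>. \<bar>Im \<xi>\<bar> < pi / 2} \<inter> {\<xi>. \<bar>Im \<xi> + Arg p\<bar> < pi}"
  define F where "F \<xi> = exp (\<xi> * b) * laplace_int a b (exp \<xi>) (exp \<xi> * p) - laplace_int a b 1 p" for \<xi>
  have p0: "p \<noteq> 0" using p by auto
  have Arg_p: "\<bar>Arg p\<bar> < pi" using Arg_margin[OF p] by (metis less_trans diff_less_eq less_add_same_cancel1)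
  have D: "D = {\<xi>. Im \<xi> < pi / 2} \<inter> {\<xi>. Im \<xi> > - pi / 2} \<inter> {\<xi>. Im \<xi> < pi - Arg p} \<inter> {\<xi>. Im \<xi> > - pi - Arg p}"
    by (auto simp: D_def)
  have op: "open D" unfolding D
    by (intro open_Int open_halfspace_Im_lt open_halfspace_Im_gt)
  have conn: "connected D" unfolding D
    by (intro convex_connected convex_Int convex_halfspace_Im_lt convex_halfspace_Im_gt)
  have hol: "F holomorphic_on D"
    unfolding holomorphic_on_open[OF op]
  proof
    fix \<xi> assume \<xi>: "\<xi> \<in> D"
    have re: "Re (0 + 1 * exp \<xi>) > 0"
      using \<xi> cos_gt_zero_pi[of "Im \<xi>"] by (auto simp: D_def Re_exp)
    have np: "p * exp \<xi> \<notin> \<real>\<^sub>\<le>\<^sub>0"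
      using mult_exp_notin_nonpos_Reals(1)[OF p0, of \<xi>] \<xi> by (auto simp: D_def mult.commute)
    have "(\<lambda>z. laplace_int a b (0 + 1 * z) (p * z)) field_differentiable (at (exp \<xi>))"
      using has_field_derivative_laplace_int[OF a b re np] field_differentiable_def by blast
    then have "((\<lambda>z. laplace_int a b (0 + 1 * z) (p * z)) \<circ> exp) field_differentiable (at \<xi>)"
      by (intro field_differentiable_compose) (auto simp: field_differentiable_def intro: DERIV_exp)
    then have *: "(\<lambda>\<xi>. laplace_int a b (exp \<xi>) (exp \<xi> * p)) field_differentiable (at \<xi>)"
      by (simp add: o_def mult.commute)
    have "(\<lambda>\<xi>. exp (\<xi> * b)) field_differentiable (at \<xi>)"
      unfolding field_differentiable_def by (rule exI, (rule derivative_eq_intros refl)+)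
    with * have "F field_differentiable (at \<xi>)"
      unfolding F_def
      by (intro field_differentiable_diff field_differentiable_mult field_differentiable_const)
    then show "\<exists>f'. (F has_field_derivative f') (at \<xi>)" by (simp add: field_differentiable_def)
  qed
  have "F (\<i> * of_real \<theta>) = 0"
  proof (rule analytic_continuation[OF hol op conn, where U = "\<real>" and \<xi> = 0])
    show "\<real> \<subseteq> D" using Arg_p by (auto simp: D_def elim!: Reals_cases)
    show "0 \<in> D" using Arg_p by (auto simp: D_def)
    show "(0::complex) islimpt \<real>"
      unfolding islimpt_approachable
    proof (intro allI impI)
      fix e :: real assume "e > 0"
      then show "\<exists>x'\<in>\<real>. x' \<noteq> 0 \<and> dist x' (0::complex) < e"
        by (intro bexI[of _ "of_real (e / 2)"]) auto
    qed
    show "\<i> * of_real \<theta> \<in> D" using \<theta> by (auto simp: D_def)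
    show "F z = 0" if "z \<in> \<real>" for z
    proof -
      from that obtain x where x: "z = of_real x" by (auto elim: Reals_cases)
      have "of_real (exp x) powr b = exp (of_real x * b)"
        by (simp add: powr_def mult.commute flip: exp_of_real)
      then show ?thesis using laplace_int_scale[OF a b p, of "exp x"]
        by (simp add: F_def x exp_of_real)
    qed
  qed
  then show ?thesis by (simp add: F_def)
qed

text \<open>With a = 0 the dependence on p disappears. This is what later identifies the growth of
  the Beta integral in c.\<close>

lemma laplace_int_0_left:
  assumes "Re b > 0" "p \<notin> \<real>\<^sub>\<le>\<^sub>0"
  shows "laplace_int 0 b 1 p = Gamma b"
proof -
  have "laplace_int 0 b 1 p = integral {0<..} (\<lambda>t. of_real t powr (b - 1) / of_real (exp t))"
    unfolding laplace_int_def
  proof (rule integral_cong)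
    fix t :: real assume "t \<in> {0<..}"
    then have "1 + p * of_real t \<noteq> 0"
      using one_plus_notin_nonpos_Reals[OF assms(2), of t] by auto
    then show "laplace_kernel 0 b 1 p t = of_real t powr (b - 1) / of_real (exp t)"
      by (simp add: laplace_kernel_def exp_minus exp_of_real divide_inverse)
  qed
  also have "\<dots> = Gamma b" using Gamma_integral_complex'[OF assms(1)] by (rule integral_unique)
  finally show ?thesis .
qed

text \<open>\<open>p \<partial>\<^sub>p\<close> acts on \<open>(1 + p s) powr (- a)\<close> as \<open>a ((1 + p s) powr (- a - 1) - (1 + p s) powr (- a))\<close>.\<close>

lemma has_field_derivative_laplace_int_right:
  assumes a: "Re a \<ge> 0" and b: "Re b > 0" and p: "p \<notin> \<real>\<^sub>\<le>\<^sub>0"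
  shows "(laplace_int a b 1 has_field_derivative
     a * (laplace_int (a + 1) b 1 p - laplace_int a b 1 p) / p) (at p)"
proof -
  have p0: "p \<noteq> 0" using p by auto
  have "laplace_kernel (a + 1) b 1 p integrable_on {0<..}"
    "laplace_kernel a b 1 p integrable_on {0<..}"
    using a b p by (auto intro!: laplace_kernel_integrable)
  then have "laplace_int (a + 1) b 1 p - laplace_int a b 1 p
      = integral {0<..} (\<lambda>s. laplace_kernel (a + 1) b 1 p s - laplace_kernel a b 1 p s)"
    by (simp add: laplace_int_def integral_diff)
  also have "\<dots> = integral {0<..} (\<lambda>s. - p * laplace_kernel (a + 1) (b + 1) 1 p s)"
  proof (rule integral_cong)
    fix s :: real assume s: "s \<in> {0<..}"
    define w where "w = 1 + p * of_real s"
    have "w \<noteq> 0" using one_plus_notin_nonpos_Reals[OF p, of s] s by (auto simp: w_def)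
    then have "w powr (- a) = w powr (- (a + 1)) * w"
      using powr_add[of w "- (a + 1)" 1] by simp
    then show "laplace_kernel (a + 1) b 1 p s - laplace_kernel a b 1 p s
        = - p * laplace_kernel (a + 1) (b + 1) 1 p s"
      using s by (simp flip: laplace_kernel_shift)
        (simp add: laplace_kernel_def flip: w_def, simp add: w_def algebra_simps)
  qed
  also have "\<dots> = - p * laplace_int (a + 1) (b + 1) 1 p"
    unfolding laplace_int_def by (rule integral_mult_right)
  finally have eq: "a * (laplace_int (a + 1) b 1 p - laplace_int a b 1 p) / p
      = - a * laplace_int (a + 1) (b + 1) 1 p"
    using p0 by simp
  show ?thesis
    using has_field_derivative_laplace_int[OF a b, of 1 0 p 1] p unfolding eq by simp
qed

section \<open>The Gauss hypergeometric function on the slit plane\<close>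

lemma mem_slit_plane_iff: "z \<in> slit_plane \<longleftrightarrow> 1 - z \<notin> \<real>\<^sub>\<le>\<^sub>0"
proof -
  have "z \<notin> slit_plane \<longleftrightarrow> Re z \<ge> 1 \<and> Im z = 0"
    unfolding slit_plane_def by (auto simp: complex_eq_iff)
  then show ?thesis by (auto simp: complex_nonpos_Reals_iff)
qed

lemma open_slit_plane: "open slit_plane"
proof -
  have eq: "slit_plane = (\<lambda>z. 1 - z) -` (- \<real>\<^sub>\<le>\<^sub>0)" by (auto simp: mem_slit_plane_iff)
  show ?thesis
    unfolding eq by (intro open_vimage open_Compl closed_nonpos_Reals_complex continuous_intros)
qed

text \<open>The slit plane is star-shaped about 0. This gives its connectedness and keeps the base
  of the power in Euler's integrand off the branch cut.\<close>

lemma one_minus_notin_nonpos_Reals: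
  assumes "z \<in> slit_plane" "0 \<le> t" "t \<le> 1"
  shows "1 - z * complex_of_real t \<notin> \<real>\<^sub>\<le>\<^sub>0"
proof (cases "Im z = 0")
  case True
  then have "Re z < 1" using assms by (auto simp: mem_slit_plane_iff complex_nonpos_Reals_iff)
  then have "Re z * t < 1"
    using assms mult_right_mono[of "Re z" 1 t]
    by (cases "t = 0"; cases "Re z \<le> 0")
      (auto intro: le_less_trans[OF mult_nonpos_nonneg] simp: mult_le_one
        intro!: le_neq_trans[OF mult_right_le_one_le[of "1::real"]], (smt (verit) mult_left_le)+)
  then show ?thesis by (auto simp: complex_nonpos_Reals_iff)
next
  case False
  then show ?thesis by (cases "t = 0") (auto simp: complex_nonpos_Reals_iff)
qed

lemma connected_slit_plane: "connected slit_plane"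
proof (rule starlike_imp_connected)
  show "starlike slit_plane"
    unfolding starlike_def
  proof (intro bexI[of _ 0] ballI subsetI)
    show "0 \<in> slit_plane" by (simp add: mem_slit_plane_iff complex_nonpos_Reals_iff)
    fix z w assume z: "z \<in> slit_plane" and "w \<in> closed_segment 0 z"
    then obtain t where "w = of_real t * z" "0 \<le> t" "t \<le> 1"
      by (auto simp: in_segment scaleR_conv_of_real)
    then show "w \<in> slit_plane"
      using one_minus_notin_nonpos_Reals[OF z, of t] by (simp add: mem_slit_plane_iff mult.commute)
  qed
qed

lemma ball_subset_slit_plane: "ball 0 1 \<subseteq> slit_plane"
proof
  fix z :: complex assume "z \<in> ball 0 1"
  then have "Re z < 1" using abs_Re_le_cmod[of z] by simp
  then show "z \<in> slit_plane" by (auto simp: mem_slit_plane_iff complex_nonpos_Reals_iff)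
qed

lemma slit_plane_identity:
  assumes "g holomorphic_on slit_plane" "\<And>u. u \<in> ball 0 1 \<Longrightarrow> g u = 0" "z \<in> slit_plane"
  shows "g z = 0"
  by (rule analytic_continuation[OF assms(1) open_slit_plane connected_slit_plane
        ball_subset_slit_plane _ _ assms(2,3), of 0])
     (use ball_subset_slit_plane in \<open>auto intro!: interior_limit_point\<close>)

text \<open>Existence of the continuation, without which the definite description in
  \<open>hyp2F1\<close> is uninformative. Kept as a predicate, it can be transported by contiguous
  relations to parameters for which Euler's integral diverges.\<close>

definition has_hyp2F1 :: "complex \<Rightarrow> complex \<Rightarrow> complex \<Rightarrow> bool" where
  "has_hyp2F1 a b c \<longleftrightarrow> (\<exists>f. f holomorphic_on slit_plane \<and>
     (\<forall>u\<in>ball 0 1. f u = eval_fps (fps_hypergeo [a, b] [c] 1) u))"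

lemma hyp2F1_eqI:
  assumes "f holomorphic_on slit_plane"
    "\<And>u. u \<in> ball 0 1 \<Longrightarrow> f u = eval_fps (fps_hypergeo [a, b] [c] 1) u"
    "z \<in> slit_plane"
  shows "hyp2F1 a b c z = f z"
  unfolding hyp2F1_def
proof (rule the_equality)
  show "\<exists>f'. f' holomorphic_on slit_plane \<and>
      (\<forall>u\<in>ball 0 1. f' u = eval_fps (fps_hypergeo [a, b] [c] 1) u) \<and> f z = f' z"
    using assms by blast
  fix y
  assume "\<exists>f'. f' holomorphic_on slit_plane \<and>
      (\<forall>u\<in>ball 0 1. f' u = eval_fps (fps_hypergeo [a, b] [c] 1) u) \<and> y = f' z"
  then obtain f' where f': "f' holomorphic_on slit_plane"
      "\<And>u. u \<in> ball 0 1 \<Longrightarrow> f' u = eval_fps (fps_hypergeo [a, b] [c] 1) u" "y = f' z"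
    by blast
  have "f' z - f z = 0"
    by (rule slit_plane_identity[of "\<lambda>z. f' z - f z"])
       (use f' assms in \<open>auto intro!: holomorphic_intros\<close>)
  then show "y = f z" using f' by simp
qed

lemma has_hyp2F1I:
  assumes "f holomorphic_on slit_plane"
    "\<And>u. u \<in> ball 0 1 \<Longrightarrow> f u = eval_fps (fps_hypergeo [a, b] [c] 1) u"
  shows "has_hyp2F1 a b c"
  using assms by (auto simp: has_hyp2F1_def)

lemma
  assumes "has_hyp2F1 a b c"
  shows holomorphic_hyp2F1: "hyp2F1 a b c holomorphic_on slit_plane"
    and hyp2F1_eq_eval_fps: "\<And>u. u \<in> ball 0 1 \<Longrightarrow>
      hyp2F1 a b c u = eval_fps (fps_hypergeo [a, b] [c] 1) u"
proof -
  obtain f where f: "f holomorphic_on slit_plane"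
    "\<And>u. u \<in> ball 0 1 \<Longrightarrow> f u = eval_fps (fps_hypergeo [a, b] [c] 1) u"
    using assms by (auto simp: has_hyp2F1_def)
  have eq: "hyp2F1 a b c z = f z" if "z \<in> slit_plane" for z
    by (rule hyp2F1_eqI) (use f that in auto)
  show "hyp2F1 a b c holomorphic_on slit_plane"
    using f(1) by (rule holomorphic_transform) (simp add: eq)
  show "hyp2F1 a b c u = eval_fps (fps_hypergeo [a, b] [c] 1) u" if "u \<in> ball 0 1" for u
    using f(2)[OF that] eq[of u] ball_subset_slit_plane that by auto
qed

lemma fps_hypergeo_2_1_swap: "fps_hypergeo [a, b] [c] x = fps_hypergeo [b, a] [c] x"
  by (simp add: fps_hypergeo_def mult_ac)

lemma hyp2F1_swap: "hyp2F1 a b c z = hyp2F1 b a c z"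
  by (simp add: hyp2F1_def fps_hypergeo_2_1_swap[of a b])

lemma has_hyp2F1_swap: "has_hyp2F1 a b c \<longleftrightarrow> has_hyp2F1 b a c"
  by (simp add: has_hyp2F1_def fps_hypergeo_2_1_swap[of a b])

section \<open>Convergence and contiguous relations of the Gauss series\<close>

lemma summable_hypergeo_2_1:
  fixes a b c z :: complex
  assumes z: "norm z < 1"
  shows "summable (\<lambda>n. fps_nth (fps_hypergeo [a, b] [c] 1) n * z ^ n)"
proof -
  define u where "u n = fps_nth (fps_hypergeo [a, b] [c] 1) n * z ^ n" for n
  \<comment> \<open>The ratio of consecutive terms, with each fraction split as 1 plus a vanishing
    term so that the limit z is visible.\<close>
  define q where "q n = (1 + (a - 1) / (1 + of_nat n)) * (1 + (b - c) / (c + of_nat n)) * z" for n :: nat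
  have lim: "filterlim (\<lambda>n. w + of_nat n) at_infinity sequentially" for w :: complex
    by (rule tendsto_add_filterlim_at_infinity[OF tendsto_const tendsto_of_nat])
  have "q \<longlonglongrightarrow> (1 + 0) * (1 + 0) * z"
    unfolding q_def by (intro tendsto_intros tendsto_divide_0[OF tendsto_const lim])
  then have "(\<lambda>n. norm (q n)) \<longlonglongrightarrow> norm z" using tendsto_norm by fastforce
  then have "eventually (\<lambda>n. norm (q n) < (1 + norm z) / 2) sequentially"
    using z by (intro order_tendstoD(2)) auto
  \<comment> \<open>If c is a nonpositive integer, one factor c + n vanishes; the ratio formula is
    used only beyond that index.\<close>
  moreover have "eventually (\<lambda>n. c + of_nat n \<noteq> 0) sequentially"
    using filterlim_at_infinity[THEN iffD1, OF _ lim[of c], of 0]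
    by (auto intro: eventually_mono[OF filterlim_at_infinity_imp_eventually_ne[OF lim[of c], of 0]])
  ultimately have "eventually (\<lambda>n. norm (q n) < (1 + norm z) / 2 \<and> c + of_nat n \<noteq> 0) sequentially"
    by (rule eventually_conj)
  then obtain N where N: "\<And>n. n \<ge> N \<Longrightarrow> norm (q n) < (1 + norm z) / 2 \<and> c + of_nat n \<noteq> 0"
    by (auto simp: eventually_sequentially)
  have "summable u"
  proof (rule summable_ratio_test[where c = "(1 + norm z) / 2" and N = N])
    show "(1 + norm z) / 2 < 1" using z by simp
    fix n assume n: "N \<le> n"
    have n0: "1 + of_nat n \<noteq> (0::complex)" by (metis of_nat_Suc of_nat_eq_0_iff nat.distinct(1))
    have "q n = (a + of_nat n) * (b + of_nat n) / ((1 + of_nat n) * (c + of_nat n)) * z"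
      using N[OF n] n0 by (simp add: q_def field_simps)
    moreover have fs: "fact (Suc n) = fact n * (1 + of_nat n :: complex)" by (simp add: algebra_simps)
    ultimately have "u (Suc n) = q n * u n"
      using fs by (simp add: u_def pochhammer_Suc mult_ac del: fact_Suc)
    then show "norm (u (Suc n)) \<le> (1 + norm z) / 2 * norm (u n)"
      using N[OF n] mult_right_mono[of "norm (q n)" "(1 + norm z) / 2" "norm (u n)"]
      by (simp add: norm_mult)
  qed
  then show ?thesis by (simp add: u_def[abs_def])
qed

lemma fps_conv_radius_hypergeo_2_1:
  fixes a b c :: complex
  shows "1 \<le> fps_conv_radius (fps_hypergeo [a, b] [c] 1)"
  unfolding fps_conv_radius_def
proof (rule conv_radius_geI_ex)
  fix r :: real assume "0 < r" "ereal r < 1"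
  then show "\<exists>z. norm z = r \<and> summable (\<lambda>n. fps_nth (fps_hypergeo [a, b] [c] 1) n * z ^ n)"
    by (intro exI[of _ "of_real r"] conjI summable_hypergeo_2_1) auto
qed

text \<open>Since a (a+1)_n = (a + n) (a)_n, comparing coefficients leaves a - b = (a + n) - (b +
  n). The denominators agree on both sides, whatever c is.\<close>

lemma hypergeo_2_1_contiguous:
  fixes a b c :: complex
  shows "fps_const (a - b) * fps_hypergeo [a, b] [c] 1 =
    fps_const a * fps_hypergeo [a + 1, b] [c] 1 - fps_const b * fps_hypergeo [a, b + 1] [c] 1"
proof (rule fps_ext)
  fix n
  have 1: "a * pochhammer (a + 1) n = (a + of_nat n) * pochhammer a n" for a :: complex
    by (metis pochhammer_Suc pochhammer_rec mult.commute)
  have "(a - b) * pochhammer a n * pochhammer b n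
      = (a * pochhammer (a + 1) n) * pochhammer b n - pochhammer a n * (b * pochhammer (b + 1) n)"
    unfolding 1 by algebra
  then show "fps_nth (fps_const (a - b) * fps_hypergeo [a, b] [c] 1) n =
      fps_nth (fps_const a * fps_hypergeo [a + 1, b] [c] 1 - fps_const b * fps_hypergeo [a, b + 1] [c] 1) n"
    by (simp add: diff_divide_distrib[symmetric] mult_ac)
qed

text \<open>Gauss's relation between neighbours in b alone. The factors \<open>fps_X\<close> mix
  coefficients of index n and n - 1, so the denominators differ and have to be nonzero, whence the
  condition on c.\<close>

lemma hypergeo_2_1_contiguous_recurrence:
  fixes a b c :: complex
  assumes c: "c \<notin> \<int>\<^sub>\<le>\<^sub>0"
  shows "fps_const (c - b) * fps_hypergeo [a, b - 1] [c] 1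
    + (fps_const (2 * b - c) + fps_const (a - b) * fps_X) * fps_hypergeo [a, b] [c] 1
    + fps_const b * (fps_X - 1) * fps_hypergeo [a, b + 1] [c] 1 = 0" (is "?L = 0")
proof (rule fps_ext)
  fix n
  show "fps_nth ?L n = fps_nth 0 n"
  proof (cases n)
    case 0
    then show ?thesis by (simp add: ring_distribs)
  next
    case (Suc m)
    have 1: "b * pochhammer (b + 1) k = (b + of_nat k) * pochhammer b k" for k and b :: complex
      by (metis pochhammer_Suc pochhammer_rec mult.commute)
    \<comment> \<open>Everything is expressed through the numerator P and denominator Q of the
      coefficient of index m = n - 1, which leaves a polynomial identity.\<close>
    define P where "P = pochhammer a m * pochhammer b m"
    define Q where "Q = pochhammer c m * fact m"
    have Q: "Q \<noteq> 0" "c + of_nat m \<noteq> 0" "1 + of_nat m \<noteq> (0::complex)"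
    proof -
      show "Q \<noteq> 0" using c by (auto simp: Q_def pochhammer_eq_0_iff)
      show "c + of_nat m \<noteq> 0" using c by (metis add_eq_0_iff minus_of_nat_in_nonpos_Ints uminus_add_conv_diff minus_minus add.commute)
      show "1 + of_nat m \<noteq> (0::complex)" by (metis of_nat_Suc of_nat_eq_0_iff nat.distinct(1))
    qed
    have e1: "fps_nth (fps_hypergeo [a, b - 1] [c] 1) n
        = P * (a + of_nat m) * (b - 1) / (Q * (c + of_nat m) * (1 + of_nat m))"
    proof -
      have "pochhammer (b - 1) n = (b - 1) * pochhammer b m"
        using pochhammer_rec[of "b - 1" m] by (simp add: Suc)
      then show ?thesis
        by simp (simp add: Suc P_def Q_def pochhammer_Suc algebra_simps)
    qed
    have e2: "fps_nth (fps_hypergeo [a, b] [c] 1) n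
        = P * (a + of_nat m) * (b + of_nat m) / (Q * (c + of_nat m) * (1 + of_nat m))"
      by (simp add: Suc P_def Q_def pochhammer_Suc algebra_simps)
    have "b * pochhammer (b + 1) n = (b + of_nat n) * pochhammer b n" by (rule 1)
    also have "\<dots> = (b + 1 + of_nat m) * ((b + of_nat m) * pochhammer b m)"
      by (simp add: Suc pochhammer_Suc mult_ac add_ac)
    finally have "b * fps_nth (fps_hypergeo [a, b + 1] [c] 1) n
        = pochhammer a n * ((b + 1 + of_nat m) * ((b + of_nat m) * pochhammer b m))
          / (pochhammer c n * fact n)"
      by (simp add: mult_ac)
    then have e3: "b * fps_nth (fps_hypergeo [a, b + 1] [c] 1) n
        = P * (a + of_nat m) * (b + of_nat m) * (b + 1 + of_nat m) / (Q * (c + of_nat m) * (1 + of_nat m))"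
      by (simp add: Suc P_def Q_def pochhammer_Suc algebra_simps)
    have e4: "fps_nth (fps_hypergeo [a, b] [c] 1) m = P / Q"
      by (simp add: P_def Q_def)
    have "b * fps_nth (fps_hypergeo [a, b + 1] [c] 1) m
        = pochhammer a m * (b * pochhammer (b + 1) m) / (pochhammer c m * fact m)"
      by (simp add: mult_ac)
    then have e5: "b * fps_nth (fps_hypergeo [a, b + 1] [c] 1) m = P * (b + of_nat m) / Q"
      unfolding 1 by (simp add: P_def Q_def mult_ac)
    have "fps_nth ?L n = (c - b) * fps_nth (fps_hypergeo [a, b - 1] [c] 1) n
        + (2 * b - c) * fps_nth (fps_hypergeo [a, b] [c] 1) n
        + (a - b) * fps_nth (fps_hypergeo [a, b] [c] 1) m
        + b * fps_nth (fps_hypergeo [a, b + 1] [c] 1) m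
        - b * fps_nth (fps_hypergeo [a, b + 1] [c] 1) n"
      by (simp add: Suc ring_distribs mult.assoc del: fps_hypergeo_nth)
    also have "\<dots> = 0"
      unfolding e1 e2 e3 e4 e5 using Q by (simp add: divide_simps) algebra
    finally show ?thesis by simp
  qed
qed

lemma one_le_fps_conv_radius:
  fixes f g :: "complex fps"
  assumes "1 \<le> fps_conv_radius f" "1 \<le> fps_conv_radius g"
  shows "1 \<le> fps_conv_radius (f * g)" "1 \<le> fps_conv_radius (f + g)" "1 \<le> fps_conv_radius (f - g)"
  using assms fps_conv_radius_mult[of f g] fps_conv_radius_add[of f g] fps_conv_radius_diff[of f g]
  by (auto intro: order_trans[rotated])

lemma eval_fps_unit_disc:
  fixes f g :: "complex fps"
  assumes "norm z < 1" "1 \<le> fps_conv_radius f" "1 \<le> fps_conv_radius g"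
  shows "eval_fps (f * g) z = eval_fps f z * eval_fps g z"
    "eval_fps (f + g) z = eval_fps f z + eval_fps g z"
    "eval_fps (f - g) z = eval_fps f z - eval_fps g z"
proof -
  have "ereal (norm z) < 1" using assms(1) by simp
  then have "ereal (norm z) < fps_conv_radius f" "ereal (norm z) < fps_conv_radius g"
    using assms(2,3) less_le_trans by blast+
  then show "eval_fps (f * g) z = eval_fps f z * eval_fps g z"
    "eval_fps (f + g) z = eval_fps f z + eval_fps g z"
    "eval_fps (f - g) z = eval_fps f z - eval_fps g z"
    by (simp_all add: eval_fps_mult eval_fps_add eval_fps_diff)
qed

lemma hyp2F1_contiguous:
  assumes "has_hyp2F1 a b c" "has_hyp2F1 (a + 1) b c" "has_hyp2F1 a (b + 1) c" "z \<in> slit_plane"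
  shows "(a - b) * hyp2F1 a b c z = a * hyp2F1 (a + 1) b c z - b * hyp2F1 a (b + 1) c z"
proof -
  have "(a - b) * hyp2F1 a b c z - (a * hyp2F1 (a + 1) b c z - b * hyp2F1 a (b + 1) c z) = 0"
  proof (rule slit_plane_identity[OF _ _ assms(4)])
    show "(\<lambda>z. (a - b) * hyp2F1 a b c z - (a * hyp2F1 (a + 1) b c z - b * hyp2F1 a (b + 1) c z))
        holomorphic_on slit_plane"
      using assms by (intro holomorphic_intros holomorphic_hyp2F1)
    show "(a - b) * hyp2F1 a b c u - (a * hyp2F1 (a + 1) b c u - b * hyp2F1 a (b + 1) c u) = 0"
      if u: "u \<in> ball 0 1" for u
      using arg_cong[OF hypergeo_2_1_contiguous[of a b c], of "\<lambda>F. eval_fps F u"] u assms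
      by (simp add: hyp2F1_eq_eval_fps eval_fps_unit_disc one_le_fps_conv_radius
          fps_conv_radius_hypergeo_2_1)
  qed
  then show ?thesis by simp
qed

text \<open>For c different from b, Gauss's relation can be solved for the term with b - 1. The
  right-hand side is holomorphic on the slit plane and has the correct series, so existence and
  value are obtained together.\<close>

lemma
  assumes c: "c \<notin> \<int>\<^sub>\<le>\<^sub>0" "c \<noteq> b" and hyp: "has_hyp2F1 a b c" "has_hyp2F1 a (b + 1) c"
  shows has_hyp2F1_minus_1: "has_hyp2F1 a (b - 1) c"
    and hyp2F1_minus_1: "\<And>z. z \<in> slit_plane \<Longrightarrow> hyp2F1 a (b - 1) c z =
      - ((2 * b - c + (a - b) * z) * hyp2F1 a b c z + b * (z - 1) * hyp2F1 a (b + 1) c z) / (c - b)"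
proof -
  define f where "f z = - ((2 * b - c + (a - b) * z) * hyp2F1 a b c z
      + b * (z - 1) * hyp2F1 a (b + 1) c z) / (c - b)" for z
  have hol: "f holomorphic_on slit_plane"
    unfolding f_def[abs_def] using hyp c by (intro holomorphic_intros holomorphic_hyp2F1) auto
  have eq: "f u = eval_fps (fps_hypergeo [a, b - 1] [c] 1) u" if u: "u \<in> ball 0 1" for u
  proof -
    have "(c - b) * eval_fps (fps_hypergeo [a, b - 1] [c] 1) u
        + (2 * b - c + (a - b) * u) * eval_fps (fps_hypergeo [a, b] [c] 1) u
        + b * (u - 1) * eval_fps (fps_hypergeo [a, b + 1] [c] 1) u = 0"
      using arg_cong[OF hypergeo_2_1_contiguous_recurrence[OF c(1), of b a], of "\<lambda>F. eval_fps F u"] u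
      by (simp add: eval_fps_unit_disc one_le_fps_conv_radius fps_conv_radius_hypergeo_2_1)
    then show ?thesis
      using c u hyp by (simp add: f_def hyp2F1_eq_eval_fps divide_simps) (simp add: algebra_simps add_eq_0_iff)
  qed
  show "has_hyp2F1 a (b - 1) c" using hol eq by (rule has_hyp2F1I)
  show "hyp2F1 a (b - 1) c z = - ((2 * b - c + (a - b) * z) * hyp2F1 a b c z
      + b * (z - 1) * hyp2F1 a (b + 1) c z) / (c - b)" if "z \<in> slit_plane" for z
    using hyp2F1_eqI[OF hol eq that] by (simp add: f_def)
qed

section \<open>Euler's integral for the Gauss function\<close>

definition beta_kernel :: "complex \<Rightarrow> complex \<Rightarrow> real \<Rightarrow> complex" where
  "beta_kernel b c t = of_real t powr (b - 1) * of_real (1 - t) powr (c - b - 1)"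

definition euler_int :: "complex \<Rightarrow> complex \<Rightarrow> complex \<Rightarrow> complex \<Rightarrow> complex" where
  "euler_int a b c u =
     integral {0<..<1} (\<lambda>t. beta_kernel b c t * (1 - u * of_real t) powr (- a))"

text \<open>Bounds on the real parts by 1 instead of 0 remove the endpoint singularities, so
  constants serve as dominating functions on the unit interval. Smaller \<open>Re b\<close> is
  reached later by lowering b.\<close>

lemma norm_beta_kernel_le_1:
  assumes "Re b \<ge> 1" "Re (c - b) \<ge> 1" "0 < t" "t < 1"
  shows "norm (beta_kernel b c t) \<le> 1"
proof -
  have "norm (beta_kernel b c t) = t powr (Re b - 1) * (1 - t) powr (Re (c - b) - 1)"
    using assms by (simp add: beta_kernel_def norm_mult norm_powr_real_powr del: of_real_diff)
  also have "\<dots> \<le> 1 * 1" using assms by (intro mult_mono powr_le1) auto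
  finally show ?thesis by simp
qed

lemma continuous_on_beta_kernel: "continuous_on {0<..<1} (beta_kernel b c)"
  unfolding beta_kernel_def continuous_on_eq_continuous_at[OF open_greaterThanLessThan]
  by (auto intro!: continuous_intros simp: complex_nonpos_Reals_iff)

lemma const_integrable_on_Ioo: "(\<lambda>_. k) integrable_on {0<..<1::real}" for k :: real
  using integrable_on_open_interval_real[of "\<lambda>_. k" 0 1] by (simp add: integrable_const_ivl)

lemma beta_kernel_times_integrable:
  assumes "Re b \<ge> 1" "Re (c - b) \<ge> 1"
    and "continuous_on {0<..<1} g" "\<And>t. 0 < t \<Longrightarrow> t < 1 \<Longrightarrow> norm (g t) \<le> B"
  shows "(\<lambda>t. beta_kernel b c t * g t) integrable_on {0<..<1}"
proof (rule continuous_dominated_integrable_on[OF _ _ const_integrable_on_Ioo])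
  show "continuous_on {0<..<1} (\<lambda>t. beta_kernel b c t * g t)"
    by (intro continuous_on_mult continuous_on_beta_kernel assms)
  show "norm (beta_kernel b c t * g t) \<le> 1 * B" if "t \<in> {0<..<1}" for t
    unfolding norm_mult using that assms by (intro mult_mono norm_beta_kernel_le_1) auto
qed auto

lemma continuous_on_one_minus_powr:
  assumes "u \<in> slit_plane"
  shows "continuous_on {0<..<1} (\<lambda>t. (1 - u * complex_of_real t) powr a)"
  unfolding continuous_on_eq_continuous_at[OF open_greaterThanLessThan]
  using one_minus_notin_nonpos_Reals[OF assms] by (auto intro!: continuous_intros)

text \<open>The power is jointly continuous on the compact set K times [0,1], because the slit plane
  is star-shaped about 0.\<close>

lemma bounded_one_minus_powr:
  assumes "K \<subseteq> slit_plane" "compact K"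
  obtains B where "\<And>u t. u \<in> K \<Longrightarrow> 0 \<le> t \<Longrightarrow> t \<le> 1 \<Longrightarrow> norm ((1 - u * complex_of_real t) powr a) \<le> B"
proof -
  have "continuous_on (K \<times> {0..1::real}) (\<lambda>x. (1 - fst x * of_real (snd x)) powr a)"
  proof (intro continuous_intros subsetI)
    fix x :: "complex \<times> real" assume "x \<in> K \<times> {0..1}"
    then have n: "1 - fst x * of_real (snd x) \<notin> \<real>\<^sub>\<le>\<^sub>0"
      using one_minus_notin_nonpos_Reals[of "fst x" "snd x"] assms(1) by auto
    then show "x \<in> {z. 0 \<le> Re (1 - fst z * of_real (snd z)) \<or> Im (1 - fst z * of_real (snd z)) \<noteq> 0}"
      unfolding complex_nonpos_Reals_iff by auto
    from n show "Re a > 0" if "1 - fst x * of_real (snd x) = 0" using that by auto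
  qed
  then have "bounded ((\<lambda>x. (1 - fst x * of_real (snd x)) powr a) ` (K \<times> {0..1::real}))"
    using assms(2) by (intro compact_imp_bounded compact_continuous_image compact_Times) auto
  then obtain B where "\<And>x. x \<in> K \<times> {0..1::real} \<Longrightarrow> norm ((1 - fst x * of_real (snd x)) powr a) \<le> B"
    unfolding bounded_iff by blast
  then show ?thesis using that by force
qed

lemma holomorphic_euler_int:
  assumes bc: "Re b \<ge> 1" "Re (c - b) \<ge> 1"
  shows "euler_int a b c holomorphic_on slit_plane"
  unfolding holomorphic_on_open[OF open_slit_plane]
proof
  fix z assume z: "z \<in> slit_plane"
  obtain r where r: "r > 0" "cball z r \<subseteq> slit_plane"
    using open_slit_plane z by (meson open_contains_cball)
  obtain B where B: "\<And>u t. u \<in> cball z r \<Longrightarrow> 0 \<le> t \<Longrightarrow> t \<le> 1 \<Longrightarrow>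
      norm ((1 - u * complex_of_real t) powr (- a)) \<le> B"
    using bounded_one_minus_powr[OF r(2) compact_cball] by blast
  obtain B' where B': "\<And>u t. u \<in> cball z r \<Longrightarrow> 0 \<le> t \<Longrightarrow> t \<le> 1 \<Longrightarrow>
      norm ((1 - u * complex_of_real t) powr (- a - 1)) \<le> B'"
    using bounded_one_minus_powr[OF r(2) compact_cball] by blast
  define f' where "f' u t = beta_kernel b c t *
      ((- a) * (1 - u * of_real t) powr (- a - 1) * (- of_real t))" for u t
  have "((\<lambda>u. integral {0<..<1} (\<lambda>t. beta_kernel b c t * (1 - u * of_real t) powr (- a)))
      has_field_derivative integral {0<..<1} (f' z)) (at z)"
  proof (rule has_field_derivative_integral_dominated[OF r(1)])
    show "(\<lambda>t. beta_kernel b c t * (1 - u * of_real t) powr (- a)) integrable_on {0<..<1}"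
      if "u \<in> ball z r" for u
      using that r B
      by (intro beta_kernel_times_integrable[OF bc, of _ B] continuous_on_one_minus_powr) auto
    show "(\<lambda>_. norm a * B') integrable_on {0<..<1::real}" by (rule const_integrable_on_Ioo)
    show "norm (f' u t) \<le> norm a * B'" if u: "u \<in> ball z r" and t: "t \<in> {0<..<1}" for u t
    proof -
      have "norm (f' u t) = norm (beta_kernel b c t) *
          (norm a * norm ((1 - u * of_real t) powr (- a - 1)) * t)"
        using t by (simp add: f'_def norm_mult)
      also have "\<dots> \<le> 1 * (norm a * B' * 1)"
      proof (intro mult_mono mult_nonneg_nonneg)
        show "norm (beta_kernel b c t) \<le> 1" using norm_beta_kernel_le_1[OF bc] t by auto
        show "norm ((1 - u * of_real t) powr (- a - 1)) \<le> B'" using B'[of u t] u t by auto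
        then show "0 \<le> B'" by (meson norm_ge_zero order_trans)
      qed (use t in auto)
      finally show ?thesis by simp
    qed
    show "((\<lambda>u. beta_kernel b c t * (1 - u * of_real t) powr (- a)) has_field_derivative f' u t) (at u)"
      if u: "u \<in> ball z r" and t: "t \<in> {0<..<1}" for u t
    proof -
      have n: "1 - u * of_real t \<notin> \<real>\<^sub>\<le>\<^sub>0"
        using one_minus_notin_nonpos_Reals[of u t] u t subsetD[OF r(2), of u] by auto
      show ?thesis
        unfolding f'_def
        apply (rule DERIV_cmult)
        apply (rule derivative_eq_intros refl n | simp)+
        done
    qed
  qed
  then show "\<exists>f'. (euler_int a b c has_field_derivative f') (at z)"
    unfolding euler_int_def[abs_def] by blast
qed

text \<open>The Beta function at (b, c - b). Only its recurrence and its growth in c are used, not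
  its expression by Gamma values.\<close>

definition beta_int :: "complex \<Rightarrow> complex \<Rightarrow> complex" where
  "beta_int b c = integral {0<..<1} (beta_kernel b c)"

text \<open>The function t^b (1 - t)^(c - b) vanishes at both endpoints, and its derivative is the
  kernel times b - c t.\<close>

lemma beta_int_plus_1:
  assumes bc: "Re b \<ge> 1" "Re (c - b) \<ge> 1"
  shows "c * beta_int (b + 1) (c + 1) = b * beta_int b c"
proof -
  define G where "G t = of_real t powr b * of_real (1 - t) powr (c - b)" for t :: real
  define g where "g t = b * beta_kernel b c t - c * beta_kernel (b + 1) (c + 1) t" for t
  have "(g has_integral (G 1 - G 0)) {0..1}"
  proof (rule fundamental_theorem_of_calculus_interior)
    show "continuous_on {0..1} G"
      unfolding G_def using bc by (intro continuous_intros) auto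
    fix t :: real assume t: "t \<in> {0<..<1}"
    have n: "complex_of_real t \<notin> \<real>\<^sub>\<le>\<^sub>0" "1 - complex_of_real t \<notin> \<real>\<^sub>\<le>\<^sub>0" "of_real t \<noteq> (0::complex)" "1 - of_real t \<noteq> (0::complex)"
      using t by (auto simp: complex_nonpos_Reals_iff complex_eq_iff)
    define T where "T = complex_of_real t powr (b - 1)"
    define U where "U = (1 - complex_of_real t) powr (c - b - 1)"
    have T: "of_real t powr b = T * of_real t"
      using powr_add[of "of_real t" "b - 1" 1] n by (simp add: T_def)
    have U: "(1 - complex_of_real t) powr (c - b) = U * (1 - of_real t)"
      using powr_add[of "1 - of_real t" "c - b - 1" 1] n by (simp add: U_def)
    have "((\<lambda>z. z powr b * (1 - z) powr (c - b)) has_field_derivative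
        (b * T) * (1 - of_real t) powr (c - b) + ((c - b) * U * (- 1)) * of_real t powr b) (at (of_real t))"
      unfolding T_def U_def by (rule derivative_eq_intros refl n | simp)+
    also have "(b * T) * (1 - of_real t) powr (c - b) + ((c - b) * U * (- 1)) * of_real t powr b = g t"
      unfolding T U g_def beta_kernel_def using T U
      by (simp flip: T_def U_def) (simp add: algebra_simps)
    finally show "(G has_vector_derivative g t) (at t)"
      unfolding G_def of_real_diff of_real_1
      by (rule has_vector_derivative_real_field)
  qed simp
  then have "(g has_integral 0) {0<..<1}"
    unfolding has_integral_Icc_iff_Ioo by (simp add: G_def)
  moreover have i: "beta_kernel b c integrable_on {0<..<1}"
      "beta_kernel (b + 1) (c + 1) integrable_on {0<..<1}"
    using bc by (auto intro!: continuous_dominated_integrable_on[OF continuous_on_beta_kernel _ const_integrable_on_Ioo[of 1]] norm_beta_kernel_le_1)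
  have "integral {0<..<1} g = b * beta_int b c - c * beta_int (b + 1) (c + 1)"
    using integral_diff[OF integrable_on_mult_right[OF i(1), of b] integrable_on_mult_right[OF i(2), of c]]
    by (simp add: g_def[abs_def] beta_int_def)
  ultimately show ?thesis by (simp add: integral_unique)
qed

lemma beta_int_plus_nat:
  assumes bc: "Re b \<ge> 1" "Re (c - b) \<ge> 1"
  shows "pochhammer c n * beta_int (b + of_nat n) (c + of_nat n) = pochhammer b n * beta_int b c"
proof (induction n)
  case (Suc n)
  have "(c + of_nat n) * beta_int (b + of_nat n + 1) (c + of_nat n + 1)
      = (b + of_nat n) * beta_int (b + of_nat n) (c + of_nat n)"
    using bc by (intro beta_int_plus_1) auto
  then have "pochhammer c n * ((c + of_nat n) * beta_int (b + of_nat n + 1) (c + of_nat n + 1))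
      = (b + of_nat n) * (pochhammer b n * beta_int b c)"
    using Suc by algebra
  then show ?case by (simp add: pochhammer_Suc add_ac mult_ac)
qed simp

lemma beta_kernel_plus_nat:
  assumes "0 < t"
  shows "beta_kernel (b + of_nat n) (c + of_nat n) t = beta_kernel b c t * of_real t ^ n"
proof -
  have "of_real t powr (b + of_nat n - 1) = of_real t powr (b - 1) * complex_of_real t ^ n"
    using powr_add[of "complex_of_real t" "b - 1" "of_nat n"] assms
    by (simp add: powr_nat' algebra_simps)
  then show ?thesis by (simp add: beta_kernel_def)
qed

text \<open>Termwise integration of the binomial series. Each kernel is bounded by 1, so the partial
  sums are dominated by the sum of |A n|, finite because |u| < 1.\<close>

lemma euler_int_sums:
  assumes bc: "Re b \<ge> 1" "Re (c - b) \<ge> 1" and u: "norm u < 1"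
  shows "(\<lambda>n. ((- a) gchoose n) * (- u) ^ n * beta_int (b + of_nat n) (c + of_nat n)) sums euler_int a b c u"
proof -
  define A where "A n = ((- a) gchoose n) * (- u) ^ n" for n
  have sA: "summable (\<lambda>n. norm (A n))"
    using norm_summable_fps[of "- u" "fps_binomial (- a)"] u
    by (simp add: A_def fps_conv_radius_binomial)
  define S where "S N t = (\<Sum>n<N. A n * beta_kernel (b + of_nat n) (c + of_nat n) t)" for N t
  have i: "beta_kernel (b + of_nat n) (c + of_nat n) integrable_on {0<..<1}" for n
    using bc by (auto intro!: continuous_dominated_integrable_on[OF continuous_on_beta_kernel _ const_integrable_on_Ioo[of 1]] norm_beta_kernel_le_1)
  have iS: "integral {0<..<1} (S N) = (\<Sum>n<N. A n * beta_int (b + of_nat n) (c + of_nat n))" for N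
    unfolding S_def[abs_def] beta_int_def
    by (subst integral_sum) (auto intro!: i integrable_on_mult_right)
  have "(\<lambda>N. integral {0<..<1} (S N)) \<longlonglongrightarrow>
      integral {0<..<1} (\<lambda>t. beta_kernel b c t * (1 - u * of_real t) powr (- a))"
  proof (rule dominated_convergence(2)[where h = "\<lambda>_. \<Sum>n. norm (A n)"])
    show "S N integrable_on {0<..<1}" for N
      unfolding S_def[abs_def] by (intro integrable_sum i integrable_on_mult_right) auto
    show "(\<lambda>_. \<Sum>n. norm (A n)) integrable_on {0<..<1::real}" by (rule const_integrable_on_Ioo)
    show "norm (S N t) \<le> (\<Sum>n. norm (A n))" if t: "t \<in> {0<..<1}" for N t
    proof -
      have "norm (S N t) \<le> (\<Sum>n<N. norm (A n) * norm (beta_kernel (b + of_nat n) (c + of_nat n) t))"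
        unfolding S_def by (rule order_trans[OF norm_sum]) (simp add: norm_mult)
      also have "\<dots> \<le> (\<Sum>n<N. norm (A n) * 1)"
        using bc t by (intro sum_mono mult_left_mono norm_beta_kernel_le_1) auto
      also have "\<dots> \<le> (\<Sum>n. norm (A n))"
        using sA by (simp add: sum_le_suminf)
      finally show ?thesis .
    qed
    show "(\<lambda>N. S N t) \<longlonglongrightarrow> beta_kernel b c t * (1 - u * of_real t) powr (- a)"
      if t: "t \<in> {0<..<1}" for t
    proof -
      have "norm (- u * of_real t) < 1"
        using u t mult_strict_mono[of "norm u" 1 t 1] by (simp add: norm_mult)
      from sums_mult[OF gen_binomial_complex[OF this, of "- a"], of "beta_kernel b c t"]
      show ?thesis
        using t unfolding sums_def S_def A_def
        by (simp add: beta_kernel_plus_nat power_mult_distrib power_minus[of "u * of_real t"] power_minus[of u] mult_ac)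
    qed
  qed
  then show ?thesis unfolding iS by (simp add: sums_def A_def euler_int_def)
qed

text \<open>The quotients of shifted Beta integrals are (b)_n / (c)_n, which turns the binomial
  coefficients into those of the Gauss series. That the normalisation is nonzero is left as a
  hypothesis, to be supplied for large c by its asymptotics.\<close>

lemma
  assumes bc: "Re b \<ge> 1" "Re (c - b) \<ge> 1" and nz: "beta_int b c \<noteq> 0"
  shows has_hyp2F1_euler: "has_hyp2F1 a b c"
    and hyp2F1_euler: "\<And>z. z \<in> slit_plane \<Longrightarrow> hyp2F1 a b c z = euler_int a b c z / beta_int b c"
proof -
  have hol: "(\<lambda>z. euler_int a b c z / beta_int b c) holomorphic_on slit_plane"
    using nz by (intro holomorphic_intros holomorphic_euler_int bc) auto
  have eq: "euler_int a b c u / beta_int b c = eval_fps (fps_hypergeo [a, b] [c] 1) u"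
    if u: "u \<in> ball 0 1" for u
  proof -
    have "c \<noteq> - of_nat m" for m
      using bc by (auto simp: complex_eq_iff)
    then have c: "pochhammer c n \<noteq> 0" for n
      by (auto simp: pochhammer_eq_0_iff)
    have "beta_int (b + of_nat n) (c + of_nat n) / beta_int b c = pochhammer b n / pochhammer c n" for n
      using beta_int_plus_nat[OF bc, of n] c[of n] nz by (simp add: divide_simps mult_ac)
    then have "((- a) gchoose n) * (- u) ^ n * beta_int (b + of_nat n) (c + of_nat n) / beta_int b c
        = pochhammer a n * pochhammer b n / (pochhammer c n * fact n) * u ^ n" for n
      by (simp add: gbinomial_pochhammer power_minus[of u] times_divide_eq_right[symmetric] del: times_divide_eq_right)
    then show ?thesis
      using sums_divide[OF euler_int_sums[OF bc, of u a], of "beta_int b c"] u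
      by (simp add: eval_fps_hypergeo_2_1 sums_iff)
  qed
  show "has_hyp2F1 a b c" using hol eq by (rule has_hyp2F1I)
  show "hyp2F1 a b c z = euler_int a b c z / beta_int b c" if "z \<in> slit_plane" for z
    using hyp2F1_eqI[OF hol eq that] .
qed

section \<open>The confluent limit\<close>

text \<open>Reduction to sequences, for which dominated convergence is available. If the limit fails
  for some e, choosing for each n a bad point of norm at least n gives a contradicting
  sequence.\<close>

lemma tendsto_at_infinity_within_sequentially:
  fixes f :: "complex \<Rightarrow> complex"
  assumes seq: "\<And>X. (\<And>n. X n \<in> S) \<Longrightarrow> filterlim X at_infinity sequentially \<Longrightarrow> (\<lambda>n. f (X n)) \<longlonglongrightarrow> L"
  shows "(f \<longlongrightarrow> L) (inf at_infinity (principal S))"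
proof (rule tendstoI, rule ccontr)
  fix e :: real assume e: "e > 0"
  assume "\<not> eventually (\<lambda>x. dist (f x) L < e) (inf at_infinity (principal S))"
  then have "\<forall>n. \<exists>x. norm x \<ge> real n \<and> x \<in> S \<and> \<not> dist (f x) L < e"
    unfolding eventually_inf_principal eventually_at_infinity by blast
  then obtain X where X: "\<And>n. norm (X n) \<ge> real n" "\<And>n. X n \<in> S" "\<And>n. \<not> dist (f (X n)) L < e"
    by metis
  have "filterlim (\<lambda>n. norm (X n)) at_top sequentially"
    by (rule filterlim_at_top_mono[OF filterlim_real_sequentially]) (simp add: X)
  then have "filterlim X at_infinity sequentially"
    by (simp add: filterlim_at_infinity_conv_norm_at_top)
  then have "eventually (\<lambda>n. dist (f (X n)) L < e) sequentially"
    using tendstoD[OF seq[of X, OF X(2)] e] by blast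
  then show False using X(3) by (auto simp: eventually_sequentially)
qed

lemma hyp2F0_sector_cos:
  assumes "c \<in> hyp2F0_sector z \<epsilon>" "\<epsilon> > 0"
  shows "\<epsilon> < pi / 2" "sin \<epsilon> > 0" "sin \<epsilon> \<le> cos (Arg c)"
proof -
  have A: "\<bar>Arg c\<bar> < pi / 2 - \<epsilon>" using assms by (auto simp: hyp2F0_sector_def)
  then show e: "\<epsilon> < pi / 2" by linarith
  show "sin \<epsilon> > 0" using e assms by (intro sin_gt_zero) auto
  have "cos (pi / 2 - \<epsilon>) \<le> cos \<bar>Arg c\<bar>"
    using A assms by (intro cos_monotone_0_pi_le) auto
  then show "sin \<epsilon> \<le> cos (Arg c)" by (simp add: cos_diff)
qed

lemma Re_eq_norm_cos_Arg: "Re c = norm c * cos (Arg c)"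
  by (metis Re_rcis rcis_cmod_Arg)

lemma sector_Re_ge:
  assumes "c \<in> hyp2F0_sector z \<epsilon>" "\<epsilon> > 0"
  shows "norm c * sin \<epsilon> \<le> Re c"
  unfolding Re_eq_norm_cos_Arg[of c] using hyp2F0_sector_cos[OF assms] by (intro mult_left_mono) auto

text \<open>In the sector Re c is at least |c| sin \<epsilon>. Thus the conditions of Euler's
  integral on c - b hold eventually, and c leaves the nonpositive integers.\<close>

lemma eventually_sector_Re_gt:
  assumes "\<epsilon> > 0"
  shows "eventually (\<lambda>c. Re c > M) (inf at_infinity (principal (hyp2F0_sector z \<epsilon>)))"
  unfolding eventually_inf_principal eventually_at_infinity
proof (intro exI allI impI)
  fix c :: complex
  assume c: "(\<bar>M\<bar> + 1) / sin \<epsilon> \<le> norm c" "c \<in> hyp2F0_sector z \<epsilon>"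
  then have "\<bar>M\<bar> + 1 \<le> norm c * sin \<epsilon>"
    using hyp2F0_sector_cos[OF c(2) assms] by (simp add: field_simps)
  then show "Re c > M" using sector_Re_ge[OF c(2) assms] by linarith
qed

lemma mult_Arg_notin_nonpos_Reals:
  assumes "c \<noteq> 0" "p \<noteq> 0" "\<bar>Arg c + Arg p\<bar> < pi"
  shows "c * p \<notin> \<real>\<^sub>\<le>\<^sub>0"
  using mult_exp_notin_nonpos_Reals(1)[of p "Ln c"] assms by (simp add: Arg_eq_Im_Ln)

lemma mult_in_slit_plane:
  assumes "c \<in> hyp2F0_sector z \<epsilon>" "\<epsilon> > 0" "z \<noteq> 0"
  shows "c * z \<in> slit_plane"
proof (cases "c = 0")
  case True
  then show ?thesis by (simp add: mem_slit_plane_iff complex_nonpos_Reals_iff)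
next
  case False
  have "c * - z \<notin> \<real>\<^sub>\<le>\<^sub>0"
    using assms False by (intro mult_Arg_notin_nonpos_Reals) (auto simp: hyp2F0_sector_def)
  from one_plus_notin_nonpos_Reals[OF this, of 1] show ?thesis by (simp add: mem_slit_plane_iff)
qed

lemma complex_eq_norm_exp_Arg: "c = of_real (norm c) * exp (\<i> * of_real (Arg c))"
  by (metis cis_conv_exp rcis_cmod_Arg rcis_def)

section \<open>The rescaled Euler integral and its limit\<close>

text \<open>Euler's integrand after t = s / |c|, up to a power of |c|; p stands for -z. The
  extension by 0 beyond |c| gives all c the same domain of integration.\<close>

definition scaled_euler_kernel :: "complex \<Rightarrow> complex \<Rightarrow> complex \<Rightarrow> complex \<Rightarrow> real \<Rightarrow> complex" where
  "scaled_euler_kernel a b p c s = (if s < norm c then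
     of_real s powr (b - 1) * of_real (1 - s / norm c) powr (c - b - 1) *
     (1 + exp (\<i> * of_real (Arg c)) * p * of_real s) powr (- a) else 0)"

lemma integral_scaled_euler_kernel:
  assumes bc: "Re b \<ge> 1" "Re (c - b) \<ge> 1" and c: "c \<noteq> 0" and z: "c * z \<in> slit_plane"
  shows "integral {0<..} (scaled_euler_kernel a b (- z) c) = of_real (norm c) powr b * euler_int a b c (c * z)"
    and "scaled_euler_kernel a b (- z) c integrable_on {0<..}"
proof -
  define R where "R = norm c"
  have R: "R > 0" using c by (simp add: R_def)
  define E where "E t = beta_kernel b c t * (1 - c * z * of_real t) powr (- a)" for t
  obtain B where B: "\<And>u t. u \<in> {c * z} \<Longrightarrow> 0 \<le> t \<Longrightarrow> t \<le> 1 \<Longrightarrow>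
      norm ((1 - u * complex_of_real t) powr (- a)) \<le> B"
    using bounded_one_minus_powr[of "{c * z}" "- a"] z by auto
  have E_le: "norm (E t) \<le> B" if "t \<in> {0<..<1}" for t
  proof -
    have "norm (E t) \<le> 1 * B"
      unfolding E_def norm_mult using that B by (intro mult_mono norm_beta_kernel_le_1 bc) auto
    then show ?thesis by simp
  qed
  have "E integrable_on {0<..<1}"
    unfolding E_def[abs_def] using B
    by (intro beta_kernel_times_integrable[OF bc, of _ B] continuous_on_one_minus_powr z) auto
  then have absE: "E absolutely_integrable_on {0<..<1}"
    using E_le const_integrable_on_Ioo[of B] by (intro absolutely_integrable_integrable_bound) auto
  have im: "(\<lambda>s. inverse R * s) ` {0<..<R} = {0<..<1}"
  proof (intro equalityI subsetI)
    fix x :: real assume "x \<in> {0<..<1}"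
    then show "x \<in> (\<lambda>s. inverse R * s) ` {0<..<R}"
      using R by (intro image_eqI[of _ _ "R * x"]) auto
  qed (use R in \<open>auto simp: field_simps\<close>)
  have eq: "scaled_euler_kernel a b (- z) c s = (if s \<in> {..<R} then of_real R powr (b - 1) * E (inverse R * s) else 0)"
    if s: "s > 0" for s
  proof -
    have "complex_of_real s = of_real R * of_real (inverse R * s)" using R by simp
    then have h1: "of_real s powr (b - 1) = of_real R powr (b - 1) * of_real (inverse R * s) powr (b - 1)"
      using R s by (simp only: powr_times_real) (subst powr_times_real, auto)
    have h2: "1 - c * z * of_real (inverse R * s) = 1 + exp (\<i> * of_real (Arg c)) * (- z) * of_real s"
      using R by (subst complex_eq_norm_exp_Arg[of c]) (simp add: R_def)
    have h3: "1 - s / R = 1 - inverse R * s" by (simp add: divide_inverse)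
    show ?thesis
      unfolding scaled_euler_kernel_def E_def beta_kernel_def R_def[symmetric]
      by (simp only: h1 h2 h3 lessThan_iff) (simp only: mult.assoc)
  qed
  have "(\<lambda>s. \<bar>inverse R\<bar> *\<^sub>R E (inverse R * s)) absolutely_integrable_on {0<..<R}"
    using absolutely_integrable_change_of_variables_real
      [of "{0<..<R}" "\<lambda>s. inverse R * s" "\<lambda>_. inverse R" E] absE R unfolding im
    by (auto intro!: derivative_eq_intros simp: inj_on_def)
  then have "(\<lambda>s. \<bar>inverse R\<bar> *\<^sub>R E (inverse R * s)) integrable_on {0<..<R}"
    by (simp add: absolutely_integrable_on_def)
  from integrable_cmul[OF this, of R] have "(\<lambda>s. E (inverse R * s)) integrable_on {0<..<R}"
    using R by simp
  then have "(\<lambda>s. of_real R powr (b - 1) * E (inverse R * s)) integrable_on {0<..<R}"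
    by (rule integrable_on_mult_right)
  then have "(\<lambda>s. if s \<in> {..<R} then of_real R powr (b - 1) * E (inverse R * s) else 0) integrable_on {0<..}"
    by (subst integrable_restrict_Int) (simp add: greaterThanLessThan_def Int_commute)
  then show "scaled_euler_kernel a b (- z) c integrable_on {0<..}"
    by (rule integrable_eq) (simp add: eq)
  have "integral {0<..} (scaled_euler_kernel a b (- z) c)
      = integral {0<..} (\<lambda>s. if s \<in> {..<R} then of_real R powr (b - 1) * E (inverse R * s) else 0)"
    by (rule integral_cong) (simp add: eq)
  also have "\<dots> = of_real R powr (b - 1) * integral {0<..<R} (\<lambda>s. E (inverse R * s))"
    by (subst integral_restrict_Int) (simp add: greaterThanLessThan_def Int_commute)
  also have "integral {0<..<R} (\<lambda>s. E (inverse R * s)) = integral {0<..<1} E / of_real (inverse R)"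
    by (rule integral_scale[OF _ _ im absE]) (use R in auto)
  also have "of_real R powr (b - 1) * \<dots> = of_real R powr b * euler_int a b c (c * z)"
    using R powr_add[of "complex_of_real R" "b - 1" 1]
    by (simp add: euler_int_def E_def[abs_def] field_simps)
  finally show "integral {0<..} (scaled_euler_kernel a b (- z) c)
      = of_real (norm c) powr b * euler_int a b c (c * z)"
    by (simp add: R_def)
qed

text \<open>From ln (1 - x) \<le> -x one gets (1 - x)^k \<le> exp (- k x). With x = s / |c| and k =
  Re (c - b) - 1 at least |c| d this is exp (- d s), independent of c.\<close>

lemma norm_scaled_euler_kernel_le:
  assumes a: "Re a \<ge> 0" and e: "0 < e" "e \<le> pi / 2" "\<bar>Arg (exp (\<i> * of_real (Arg c)) * p)\<bar> \<le> pi - e"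
    and s: "s > 0" and d: "d \<ge> 0" "Re (c - b) - 1 \<ge> norm c * d"
  shows "norm (scaled_euler_kernel a b p c s)
    \<le> sin e powr (- Re a) * exp (pi * \<bar>Im a\<bar>) * (s powr (Re b - 1) * exp (- (d * s)))"
proof (cases "s < norm c")
  case False
  then show ?thesis by (simp add: scaled_euler_kernel_def)
next
  case True
  define R where "R = norm c"
  have R: "R > 0" "s < R" using True s by (auto simp: R_def)
  define x where "x = s / R"
  have x: "0 < x" "x < 1" using R s by (auto simp: x_def)
  have "sin e > 0" using e by (intro sin_gt_zero) auto
  then have 1: "norm ((1 + exp (\<i> * of_real (Arg c)) * p * of_real s) powr (- a))
      \<le> sin e powr (- Re a) * exp (pi * \<bar>Im a\<bar>)"
    using sin_le_norm_1_plus[OF e(3,1,2)] s a by (intro norm_powr_minus_le) auto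
  have "norm (of_real (1 - x) powr (c - b - 1)) = exp ((Re (c - b) - 1) * ln (1 - x))"
    using x by (simp add: norm_powr_real_powr powr_def del: of_real_diff)
  also have "\<dots> \<le> exp (- (d * s))"
  proof -
    have 2: "ln (1 - x) \<le> - x" using ln_add_one_self_le_self2[of "- x"] x by simp
    have "(R * d) * x \<le> (Re (c - b) - 1) * x"
      using d x unfolding R_def by (intro mult_right_mono) auto
    moreover have "(R * d) * x = d * s" using R by (simp add: x_def)
    moreover have "Re (c - b) - 1 \<ge> 0"
      using d mult_nonneg_nonneg[OF norm_ge_zero[of c] d(1)] by linarith
    with 2 have "(Re (c - b) - 1) * ln (1 - x) \<le> (Re (c - b) - 1) * (- x)"
      by (rule mult_left_mono)
    ultimately show ?thesis by simp
  qed
  finally have 2: "norm (of_real (1 - x) powr (c - b - 1)) \<le> exp (- (d * s))" .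
  have 3: "norm (of_real s powr (b - 1)) = s powr (Re b - 1)"
    using s by (simp add: norm_powr_real_powr)
  have "norm (scaled_euler_kernel a b p c s)
      \<le> s powr (Re b - 1) * exp (- (d * s)) * (sin e powr (- Re a) * exp (pi * \<bar>Im a\<bar>))"
    using R 3 unfolding scaled_euler_kernel_def R_def[symmetric] x_def[symmetric]
    by (auto simp: norm_mult simp del: of_real_diff intro!: mult_mono 1 2)
  then show ?thesis by (simp add: mult_ac)
qed


text \<open>The directions of \<open>X n\<close> need not converge, so neither kernel need have a
  limit of its own; only their difference tends to 0.\<close>

lemma scaled_euler_kernel_tendsto:
  assumes a: "Re a \<ge> 0" and e: "0 < e" "e \<le> pi / 2" and s: "s > 0"
    and X: "filterlim X at_infinity sequentially"
    and cos: "\<And>n. cos (Arg (X n)) \<ge> 0"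
    and Arg: "\<And>n. \<bar>Arg (exp (\<i> * of_real (Arg (X n))) * p)\<bar> \<le> pi - e"
  shows "(\<lambda>n. scaled_euler_kernel a b p (X n) s -
    laplace_kernel a b (exp (\<i> * of_real (Arg (X n)))) (exp (\<i> * of_real (Arg (X n))) * p) s) \<longlonglongrightarrow> 0"
proof -
  define R where "R n = norm (X n)" for n
  define E where "E n = exp (\<i> * of_real (Arg (X n)))" for n
  define H where "H n = (1 + E n * p * of_real s) powr (- a)" for n
  define W where "W n = exp (- (E n * of_real s))" for n
  \<comment> \<open>The logarithm of the ratio between (1 - s/R)^(X - b - 1) and exp (- E s). Its
    first part is of order s^2 / R, its second of order s / R.\<close>
  define D where "D n = E n * of_real (R n * (ln (1 - s / R n) + s / R n)) - (b + 1) * of_real (ln (1 - s / R n))" for n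
  define K where "K = sin e powr (- Re a) * exp (pi * \<bar>Im a\<bar>)"
  have R: "filterlim R at_top sequentially"
    using X unfolding R_def by (rule filterlim_at_infinity_imp_norm_at_top)
  have XR: "X n = of_real (R n) * E n" for n
    unfolding R_def E_def by (rule complex_eq_norm_exp_Arg)
  have nE: "norm (E n) = 1" for n by (simp add: E_def norm_exp_eq_Re)
  have reE: "Re (E n) \<ge> 0" for n using cos[of n] by (simp add: E_def Re_exp)
  have "sin e > 0" using e by (intro sin_gt_zero) auto
  then have nH: "norm (H n) \<le> K" for n
    unfolding H_def K_def E_def using sin_le_norm_1_plus[OF Arg[of n] e] s a
    by (intro norm_powr_minus_le) auto
  have nW: "norm (W n) \<le> 1" for n
    using reE[of n] s by (simp add: W_def norm_exp_eq_Re)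
  have lim0: "(\<lambda>n. s / R n) \<longlonglongrightarrow> 0"
    using R by (rule real_tendsto_divide_at_top[OF tendsto_const])
  have limln: "(\<lambda>n. ln (1 - s / R n)) \<longlonglongrightarrow> 0"
    using tendsto_ln[OF tendsto_diff[OF tendsto_const lim0, of 1]] by simp
  have "(\<lambda>n. 2 * s * (s / R n)) \<longlonglongrightarrow> 2 * s * 0" by (intro tendsto_intros lim0)
  then have lim1: "(\<lambda>n. 2 * s * (s / R n)) \<longlonglongrightarrow> 0" by simp
  \<comment> \<open>This makes s / R less than 1/2, the range of the quadratic bound on the
    logarithm.\<close>
  have ev: "eventually (\<lambda>n. R n > 2 * s) sequentially"
    using R by (simp add: filterlim_at_top_dense)
  have "(\<lambda>n. R n * (ln (1 - s / R n) + s / R n)) \<longlonglongrightarrow> 0"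
  proof (rule Lim_null_comparison[OF _ lim1])
    show "eventually (\<lambda>n. norm (R n * (ln (1 - s / R n) + s / R n)) \<le> 2 * s * (s / R n)) sequentially"
      using ev
    proof eventually_elim
      case (elim n)
      then have Rn: "R n > 0" using s by linarith
      have "\<bar>ln (1 + - (s / R n)) - (- (s / R n))\<bar> \<le> 2 * (- (s / R n))\<^sup>2"
        using elim s Rn by (intro abs_ln_one_plus_x_minus_x_bound) (simp add: field_simps)
      then have "R n * \<bar>ln (1 - s / R n) + s / R n\<bar> \<le> R n * (2 * (s / R n)\<^sup>2)"
        using Rn by (intro mult_left_mono) auto
      also have "\<dots> = 2 * s * (s / R n)" using Rn by (simp add: power2_eq_square)
      finally show ?case using Rn by (simp add: abs_mult)
    qed
  qed
  then have "(\<lambda>n. norm (E n * of_real (R n * (ln (1 - s / R n) + s / R n)))) \<longlonglongrightarrow> 0"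
    by (simp only: norm_mult nE norm_of_real mult_1) (rule tendsto_rabs_zero)
  then have "(\<lambda>n. E n * of_real (R n * (ln (1 - s / R n) + s / R n))) \<longlonglongrightarrow> 0"
    by (rule tendsto_norm_zero_cancel)
  moreover have "(\<lambda>n. (b + 1) * of_real (ln (1 - s / R n))) \<longlonglongrightarrow> (b + 1) * of_real 0"
    by (intro tendsto_intros limln)
  ultimately have "D \<longlonglongrightarrow> 0 - (b + 1) * of_real 0"
    unfolding D_def[abs_def] by (rule tendsto_diff)
  then have "(\<lambda>n. exp (D n) - 1) \<longlonglongrightarrow> exp 0 - 1"
    by (intro tendsto_intros) simp
  then have "(\<lambda>n. norm (exp (D n) - 1)) \<longlonglongrightarrow> 0"
    using tendsto_norm by fastforce
  then have lim2: "(\<lambda>n. s powr (Re b - 1) * norm (exp (D n) - 1) * K) \<longlonglongrightarrow> 0"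
    by (intro tendsto_mult_left_zero tendsto_mult_right_zero)
  show ?thesis
  proof (rule Lim_null_comparison[OF _ lim2])
    show "eventually (\<lambda>n. norm (scaled_euler_kernel a b p (X n) s -
        laplace_kernel a b (exp (\<i> * of_real (Arg (X n)))) (exp (\<i> * of_real (Arg (X n))) * p) s)
        \<le> s powr (Re b - 1) * norm (exp (D n) - 1) * K) sequentially"
      using ev
    proof eventually_elim
      case (elim n)
      then have Rn: "R n > 0" "s < R n" using s by linarith+
      then have x: "1 - s / R n > 0" by simp
      have "of_real (1 - s / R n) powr (X n - b - 1) = exp ((X n - b - 1) * of_real (ln (1 - s / R n)))"
        using x by (subst powr_def) (auto simp: Ln_of_real simp del: of_real_diff)
      also have "(X n - b - 1) * of_real (ln (1 - s / R n)) = D n - E n * of_real s"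
        using Rn unfolding D_def XR by (simp add: algebra_simps)
      also have "exp \<dots> = W n * exp (D n)"
        by (simp add: W_def exp_diff exp_minus field_simps)
      finally have V: "of_real (1 - s / R n) powr (X n - b - 1) = W n * exp (D n)" .
      have "scaled_euler_kernel a b p (X n) s - laplace_kernel a b (E n) (E n * p) s
          = of_real s powr (b - 1) * (W n * (exp (D n) - 1)) * H n"
        using Rn V unfolding scaled_euler_kernel_def laplace_kernel_def
        by (simp add: R_def[symmetric] E_def[symmetric] H_def W_def algebra_simps del: of_real_diff)
      also have "norm \<dots> = s powr (Re b - 1) * (norm (W n) * norm (exp (D n) - 1)) * norm (H n)"
        using s by (simp add: norm_mult norm_powr_real_powr)
      also have "\<dots> \<le> s powr (Re b - 1) * (1 * norm (exp (D n) - 1)) * K"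
        by (intro mult_mono mult_left_mono mult_nonneg_nonneg nW nH) auto
      finally show ?case by (simp add: E_def)
    qed
  qed
qed


lemma powr_eq_norm_powr_exp_Arg:
  assumes "c \<noteq> 0"
  shows "c powr b = of_real (norm c) powr b * exp (\<i> * of_real (Arg c) * b)"
proof -
  have "Ln c = of_real (ln (norm c)) + \<i> * of_real (Arg c)"
    using assms by (simp add: complex_eq_iff Arg_eq_Im_Ln)
  then show ?thesis
    using assms by (simp add: powr_def Ln_of_real exp_add[symmetric] algebra_simps)
qed

text \<open>The factor c^b splits into |c|^b, absorbed by the substitution, and the phase exp (i b
  Arg c), which is exactly the factor that rotates the ray of direction Arg c back to the real
  axis.\<close>

lemma euler_int_tendsto:
  assumes a: "Re a \<ge> 0" and b: "Re b \<ge> 1" and z: "- z \<notin> \<real>\<^sub>\<le>\<^sub>0" and \<epsilon>: "\<epsilon> > 0"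
  shows "((\<lambda>c. c powr b * euler_int a b c (c * z)) \<longlongrightarrow> laplace_int a b 1 (- z))
    (inf at_infinity (principal (hyp2F0_sector z \<epsilon>)))"
proof (rule tendsto_at_infinity_within_sequentially)
  fix X0 assume X0S: "\<And>n. X0 n \<in> hyp2F0_sector z \<epsilon>" and X0: "filterlim X0 at_infinity sequentially"
  have z0: "z \<noteq> 0" using z by auto
  \<comment> \<open>Half of the available decay rate sin \<epsilon>; once |c| d exceeds Re b + 1,
    the other half absorbs the shift by b + 1 in the exponent.\<close>
  define d where "d = sin \<epsilon> / 2"
  have \<epsilon>': "\<epsilon> \<le> pi / 2" and d: "d > 0"
    using hyp2F0_sector_cos[OF X0S[of 0] \<epsilon>] by (auto simp: d_def)
  have "filterlim (\<lambda>n. norm (X0 n)) at_top sequentially"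
    using X0 by (rule filterlim_at_infinity_imp_norm_at_top)
  then have "eventually (\<lambda>n. norm (X0 n) > (Re b + 1) / d) sequentially"
    by (simp add: filterlim_at_top_dense)
  then obtain N where N: "\<And>n. n \<ge> N \<Longrightarrow> norm (X0 n) > (Re b + 1) / d"
    by (auto simp: eventually_sequentially)
  define X where "X n = X0 (n + N)" for n
  have XS: "X n \<in> hyp2F0_sector z \<epsilon>" for n by (simp add: X_def X0S)
  have X: "filterlim X at_infinity sequentially"
    unfolding X_def using X0 by (rule filterlim_compose) (rule filterlim_add_const_nat_at_top)
  have big: "Re b + 1 < norm (X n) * d" for n
    using N[of "n + N"] d by (simp add: X_def field_simps)
  have Xnz: "X n \<noteq> 0" for n using b big[of n] by auto
  have Re_X: "Re (X n - b) - 1 \<ge> norm (X n) * d" for n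
    using sector_Re_ge[OF XS[of n] \<epsilon>] big[of n] by (simp add: d_def)
  have ReX1: "Re (X n - b) \<ge> 1" for n
    using Re_X[of n] big[of n] b by linarith
  define E where "E n = exp (\<i> * of_real (Arg (X n)))" for n
  have cosX: "cos (Arg (X n)) \<ge> 2 * d" for n
    using hyp2F0_sector_cos(3)[OF XS[of n] \<epsilon>] by (simp add: d_def)
  have sec: "\<bar>Arg (X n)\<bar> < pi / 2 - \<epsilon>" "\<bar>Arg (X n) + Arg (- z)\<bar> < pi - \<epsilon>" for n
    using XS[of n] by (auto simp: hyp2F0_sector_def)
  have Arg_E: "Arg (E n * - z) = Arg (X n) + Arg (- z)" and E_np: "E n * - z \<notin> \<real>\<^sub>\<le>\<^sub>0" for n
    using mult_exp_notin_nonpos_Reals[of "- z" "\<i> * of_real (Arg (X n))"] z0 sec[of n] \<epsilon>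
    by (auto simp: E_def)
  have Arg_E': "\<bar>Arg (E n * - z)\<bar> \<le> pi - \<epsilon>" for n using Arg_E[of n] sec(2)[of n] by simp
  have Re_E: "Re (E n) \<ge> 2 * d" for n using cosX[of n] by (simp add: E_def Re_exp)
  define K where "K = sin \<epsilon> powr (- Re a) * exp (pi * \<bar>Im a\<bar>)"
  define g where "g n s = scaled_euler_kernel a b (- z) (X n) s - laplace_kernel a b (E n) (E n * - z) s" for n s
  have slit: "X n * z \<in> slit_plane" for n using mult_in_slit_plane[OF XS \<epsilon> z0] .
  have int1: "scaled_euler_kernel a b (- z) (X n) integrable_on {0<..}" for n
    by (rule integral_scaled_euler_kernel(2)[OF b ReX1 Xnz slit])
  have int2: "laplace_kernel a b (E n) (E n * - z) integrable_on {0<..}" for n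
    using a b d Re_E[of n] E_np[of n] by (intro laplace_kernel_integrable) auto
  have "(\<lambda>n. integral {0<..} (g n)) \<longlonglongrightarrow> integral {0<..} (\<lambda>_::real. 0::complex)"
  proof (rule dominated_convergence(2)[where h = "\<lambda>s. 2 * K * (s powr (Re b - 1) * exp (- (d * s)))"])
    show "g n integrable_on {0<..}" for n
      unfolding g_def[abs_def] by (intro integrable_diff int1 int2)
    show "(\<lambda>s. 2 * K * (s powr (Re b - 1) * exp (- (d * s)))) integrable_on {0<..}"
      using b d by (intro integrable_on_mult_right powr_exp_integrable) auto
    show "norm (g n s) \<le> 2 * K * (s powr (Re b - 1) * exp (- (d * s)))" if s: "s \<in> {0<..}" for n s
    proof -
      have "norm (scaled_euler_kernel a b (- z) (X n) s) \<le> K * (s powr (Re b - 1) * exp (- (d * s)))"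
        unfolding K_def
        by (rule norm_scaled_euler_kernel_le[OF a \<epsilon> \<epsilon>' Arg_E'[unfolded E_def] _ _ Re_X]) (use s d in auto)
      moreover have "norm (laplace_kernel a b (E n) (E n * - z) s) \<le> K * (s powr (Re b - 1) * exp (- (d * s)))"
        unfolding K_def
        by (rule norm_laplace_kernel_le[OF a \<epsilon> \<epsilon>' Arg_E']) (use s d Re_E[of n] in auto)
      ultimately have "norm (scaled_euler_kernel a b (- z) (X n) s) + norm (laplace_kernel a b (E n) (E n * - z) s)
          \<le> 2 * K * (s powr (Re b - 1) * exp (- (d * s)))"
        by linarith
      then show ?thesis
        unfolding g_def by (rule order_trans[OF norm_triangle_ineq4])
    qed
    show "(\<lambda>n. g n s) \<longlonglongrightarrow> 0" if s: "s \<in> {0<..}" for s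
      unfolding g_def E_def
    proof (rule scaled_euler_kernel_tendsto[OF a \<epsilon> \<epsilon>' _ X])
      show "0 \<le> cos (Arg (X n))" for n using cosX[of n] d by simp
    qed (use s Arg_E' in \<open>auto simp: E_def\<close>)
  qed
  then have "(\<lambda>n. norm (integral {0<..} (g n))) \<longlonglongrightarrow> 0" by (simp add: tendsto_norm_zero_iff)
  then have lim: "(\<lambda>n. exp (pi * \<bar>Im b\<bar>) * norm (integral {0<..} (g n))) \<longlonglongrightarrow> 0"
    by (rule tendsto_mult_right_zero)
  \<comment> \<open>Multiplied by its phase, the rotated Laplace integral no longer depends on n.
    For nonreal b the phase is not unimodular, but its norm is at most exp (pi |Im b|).\<close>
  have eq: "X n powr b * euler_int a b (X n) (X n * z) - laplace_int a b 1 (- z)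
      = exp (\<i> * of_real (Arg (X n)) * b) * integral {0<..} (g n)" for n
  proof -
    have "integral {0<..} (g n) = of_real (norm (X n)) powr b * euler_int a b (X n) (X n * z)
        - laplace_int a b (E n) (E n * - z)"
      unfolding g_def[abs_def] laplace_int_def
      using int1 int2 integral_scaled_euler_kernel(1)[OF b ReX1 Xnz slit, of a]
      by (simp add: integral_diff)
    moreover have "exp (\<i> * of_real (Arg (X n)) * b) * laplace_int a b (E n) (E n * - z)
        = laplace_int a b 1 (- z)"
      unfolding E_def using b sec[of n] \<epsilon> by (intro laplace_int_rotate[OF a _ z]) auto
    ultimately show ?thesis
      unfolding powr_eq_norm_powr_exp_Arg[OF Xnz] by algebra
  qed
  have "(\<lambda>n. X n powr b * euler_int a b (X n) (X n * z) - laplace_int a b 1 (- z)) \<longlonglongrightarrow> 0"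
  proof (rule Lim_null_comparison[OF always_eventually lim], intro allI)
    fix n
    have "Im b * Arg (X n) \<ge> - (pi * \<bar>Im b\<bar>)"
    proof -
      have "\<bar>Im b * Arg (X n)\<bar> \<le> \<bar>Im b\<bar> * pi"
        unfolding abs_mult using sec(1)[of n] \<epsilon> by (intro mult_left_mono) auto
      then show ?thesis by (simp add: mult.commute abs_le_iff)
    qed
    then have "norm (exp (\<i> * of_real (Arg (X n)) * b)) \<le> exp (pi * \<bar>Im b\<bar>)"
      by (simp add: norm_exp_eq_Re mult.commute)
    then show "norm (X n powr b * euler_int a b (X n) (X n * z) - laplace_int a b 1 (- z))
        \<le> exp (pi * \<bar>Im b\<bar>) * norm (integral {0<..} (g n))"
      unfolding eq norm_mult by (intro mult_right_mono) auto
  qed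
  then have "(\<lambda>n. X n powr b * euler_int a b (X n) (X n * z)) \<longlonglongrightarrow> laplace_int a b 1 (- z)"
    by (rule LIM_zero_cancel)
  then show "(\<lambda>n. X0 n powr b * euler_int a b (X0 n) (X0 n * z)) \<longlonglongrightarrow> laplace_int a b 1 (- z)"
    unfolding X_def by (rule LIMSEQ_offset)
qed

lemma euler_int_0_left:
  assumes "u \<in> slit_plane"
  shows "euler_int 0 b c u = beta_int b c"
  unfolding euler_int_def beta_int_def
proof (rule integral_cong)
  fix t :: real assume "t \<in> {0<..<1}"
  then have "1 - u * of_real t \<noteq> 0"
    using one_minus_notin_nonpos_Reals[OF assms, of t] by auto
  then show "beta_kernel b c t * (1 - u * of_real t) powr (- 0) = beta_kernel b c t" by simp
qed

lemma
  assumes a: "Re a \<ge> 0" and b: "Re b \<ge> 1" and z: "- z \<notin> \<real>\<^sub>\<le>\<^sub>0" and \<epsilon>: "\<epsilon> > 0"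
  defines "F \<equiv> inf at_infinity (principal (hyp2F0_sector z \<epsilon>))"
  shows eventually_has_hyp2F1_base: "eventually (\<lambda>c. has_hyp2F1 a b c) F"
    and hyp2F1_tendsto_base: "((\<lambda>c. hyp2F1 a b c (c * z)) \<longlongrightarrow> laplace_int a b 1 (- z) / Gamma b) F"
proof -
  have z0: "z \<noteq> 0" using z by auto
  have "eventually (\<lambda>c. c \<in> hyp2F0_sector z \<epsilon>) F"
    unfolding F_def by (simp add: eventually_inf_principal)
  moreover have "eventually (\<lambda>c. Re c > \<bar>Re b\<bar> + 1) F"
    unfolding F_def by (rule eventually_sector_Re_gt[OF \<epsilon>])
  ultimately have ev1: "eventually (\<lambda>c. c * z \<in> slit_plane \<and> Re (c - b) \<ge> 1 \<and> c \<noteq> 0) F"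
    by eventually_elim (use mult_in_slit_plane[OF _ \<epsilon> z0] in auto)
  have "Gamma b \<noteq> 0" using b by (auto simp: Gamma_eq_zero_iff elim!: nonpos_Ints_cases)
  \<comment> \<open>For a = 0 Euler's integral is the Beta integral and the Laplace integral is
    \<open>Gamma b\<close>, so the limit just proved gives the growth of the denominator.\<close>
  have "((\<lambda>c. c powr b * euler_int 0 b c (c * z)) \<longlongrightarrow> Gamma b) F"
    using euler_int_tendsto[of 0 b z \<epsilon>] laplace_int_0_left[of b "- z"] b z \<epsilon> by (simp add: F_def)
  then have lim: "((\<lambda>c. c powr b * beta_int b c) \<longlongrightarrow> Gamma b) F"
    by (rule Lim_transform_eventually) (use ev1 in eventually_elim, simp add: euler_int_0_left)
  then have "eventually (\<lambda>c. c powr b * beta_int b c \<noteq> 0) F"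
    using \<open>Gamma b \<noteq> 0\<close> by (rule tendsto_imp_eventually_ne)
  with ev1 have ev: "eventually (\<lambda>c. c * z \<in> slit_plane \<and> Re (c - b) \<ge> 1 \<and> c \<noteq> 0 \<and> beta_int b c \<noteq> 0) F"
    by eventually_elim auto
  then show "eventually (\<lambda>c. has_hyp2F1 a b c) F"
    by eventually_elim (use has_hyp2F1_euler[OF b] in auto)
  have "((\<lambda>c. (c powr b * euler_int a b c (c * z)) / (c powr b * beta_int b c))
      \<longlongrightarrow> laplace_int a b 1 (- z) / Gamma b) F"
    using lim euler_int_tendsto[OF a b z \<epsilon>] \<open>Gamma b \<noteq> 0\<close> unfolding F_def by (intro tendsto_divide) auto
  then show "((\<lambda>c. hyp2F1 a b c (c * z)) \<longlongrightarrow> laplace_int a b 1 (- z) / Gamma b) F"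
    by (rule Lim_transform_eventually)
       (use ev in eventually_elim, use hyp2F1_euler[OF b] in \<open>auto simp: powr_def\<close>)
qed

section \<open>Existence, uniqueness and contiguous relations of the confluent limit\<close>

text \<open>Eventual existence of the continuation is included because contiguous relations between
  values of \<open>hyp2F1\<close> are available only where it holds.\<close>

definition has_hyp2F0 :: "complex \<Rightarrow> complex \<Rightarrow> complex \<Rightarrow> complex \<Rightarrow> bool" where
  "has_hyp2F0 a b z L \<longleftrightarrow> (\<forall>\<epsilon>>0.
     eventually (has_hyp2F1 a b) (inf at_infinity (principal (hyp2F0_sector z \<epsilon>))) \<and>
     ((\<lambda>c. hyp2F1 a b c (c * z)) \<longlongrightarrow> L) (inf at_infinity (principal (hyp2F0_sector z \<epsilon>))))"

text \<open>For large \<epsilon> the sector is empty and every number is a limit. Uniqueness needs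
  one \<epsilon> for which the sector is unbounded; half the margin of -z works, as the positive
  axis then lies in it.\<close>

lemma sector_filter_neq_bot:
  assumes "- z \<notin> \<real>\<^sub>\<le>\<^sub>0"
  obtains \<epsilon> where "\<epsilon> > 0" "inf at_infinity (principal (hyp2F0_sector z \<epsilon>)) \<noteq> bot"
proof -
  obtain e where e: "0 < e" "e \<le> pi / 2" "\<bar>Arg (- z)\<bar> < pi - e"
    using Arg_margin[OF assms] .
  have "eventually (\<lambda>x. complex_of_real x \<in> hyp2F0_sector z (e / 2)) at_top"
    using eventually_gt_at_top[of 0]
    by eventually_elim (use e in \<open>auto simp: hyp2F0_sector_def Arg_of_real\<close>)
  moreover have "filterlim complex_of_real at_infinity at_top"
    by (rule filterlim_of_real_at_infinity)
  ultimately have "filterlim complex_of_real (inf at_infinity (principal (hyp2F0_sector z (e / 2)))) at_top"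
    by (simp add: filterlim_inf filterlim_principal)
  then have le: "filtermap complex_of_real at_top \<le> inf at_infinity (principal (hyp2F0_sector z (e / 2)))"
    by (simp only: filterlim_def)
  have "inf at_infinity (principal (hyp2F0_sector z (e / 2))) \<noteq> bot"
  proof
    assume "inf at_infinity (principal (hyp2F0_sector z (e / 2))) = bot"
    with le show False by (simp only: bot_unique filtermap_bot_iff) simp
  qed
  then show ?thesis using that[of "e / 2"] e by simp
qed

lemma hyp2F0_eqI:
  assumes z: "- z \<notin> \<real>\<^sub>\<le>\<^sub>0" and L: "has_hyp2F0 a b z L"
  shows "hyp2F0 a b z = L"
  unfolding hyp2F0_def
proof (rule the_equality)
  show "\<forall>\<epsilon>>0. ((\<lambda>c. hyp2F1 a b c (c * z)) \<longlongrightarrow> L) (inf at_infinity (principal (hyp2F0_sector z \<epsilon>)))"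
    using L by (simp add: has_hyp2F0_def)
  fix M
  assume M: "\<forall>\<epsilon>>0. ((\<lambda>c. hyp2F1 a b c (c * z)) \<longlongrightarrow> M) (inf at_infinity (principal (hyp2F0_sector z \<epsilon>)))"
  obtain \<epsilon> where "\<epsilon> > 0" "inf at_infinity (principal (hyp2F0_sector z \<epsilon>)) \<noteq> bot"
    using sector_filter_neq_bot[OF z] .
  then show "M = L" using M L tendsto_unique unfolding has_hyp2F0_def by blast
qed

lemma has_hyp2F0_swap: "has_hyp2F0 a b z L \<longleftrightarrow> has_hyp2F0 b a z L"
  unfolding has_hyp2F0_def hyp2F1_swap[of a b] has_hyp2F1_swap[of a b] ..

lemma hyp2F0_swap: "hyp2F0 a b z = hyp2F0 b a z"
  unfolding hyp2F0_def hyp2F1_swap[of a b] ..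

text \<open>Gauss's relation at c z divided by c: its three coefficients tend to 1, (a - b) z - 1
  and b z.\<close>

lemma has_hyp2F0_minus_1:
  assumes z: "z \<noteq> 0" and L: "has_hyp2F0 a b z L" "has_hyp2F0 a (b + 1) z L'"
  shows "has_hyp2F0 a (b - 1) z ((1 - (a - b) * z) * L - b * z * L')"
  unfolding has_hyp2F0_def
proof (intro allI impI conjI)
  fix \<epsilon> :: real assume \<epsilon>: "\<epsilon> > 0"
  define F where "F = inf at_infinity (principal (hyp2F0_sector z \<epsilon>))"
  have "eventually (\<lambda>c. c \<in> hyp2F0_sector z \<epsilon>) F"
    unfolding F_def by (simp add: eventually_inf_principal)
  moreover have "eventually (\<lambda>c. Re c > \<bar>Re b\<bar>) F"
    unfolding F_def by (rule eventually_sector_Re_gt[OF \<epsilon>])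
  ultimately have ev: "eventually (\<lambda>c. c * z \<in> slit_plane \<and> c \<notin> \<int>\<^sub>\<le>\<^sub>0 \<and> c \<noteq> b \<and> c \<noteq> 0) F"
    by eventually_elim (use mult_in_slit_plane[OF _ \<epsilon> z] in \<open>auto elim!: nonpos_Ints_cases\<close>)
  have evs: "eventually (has_hyp2F1 a b) F" "eventually (has_hyp2F1 a (b + 1)) F"
    using L \<epsilon> by (simp_all add: has_hyp2F0_def F_def)
  show "eventually (has_hyp2F1 a (b - 1)) F"
    using ev evs by eventually_elim (use has_hyp2F1_minus_1 in blast)
  have inv: "(inverse \<longlongrightarrow> (0::complex)) F"
    using tendsto_inverse_0 by (rule tendsto_mono[rotated]) (simp add: F_def)
  have lims: "((\<lambda>c. hyp2F1 a b c (c * z)) \<longlongrightarrow> L) F" "((\<lambda>c. hyp2F1 a (b + 1) c (c * z)) \<longlongrightarrow> L') F"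
    using L \<epsilon> by (simp_all add: has_hyp2F0_def F_def)
  have "((\<lambda>c. - ((2 * b * inverse c - 1 + (a - b) * z) * hyp2F1 a b c (c * z)
      + b * (z - inverse c) * hyp2F1 a (b + 1) c (c * z)) / (1 - b * inverse c)) \<longlongrightarrow>
      - ((2 * b * 0 - 1 + (a - b) * z) * L + b * (z - 0) * L') / (1 - b * 0)) F"
    by (intro tendsto_intros inv lims) auto
  also have "- ((2 * b * 0 - 1 + (a - b) * z) * L + b * (z - 0) * L') / (1 - b * 0)
      = (1 - (a - b) * z) * L - b * z * L'"
    by (simp add: algebra_simps)
  finally show "((\<lambda>c. hyp2F1 a (b - 1) c (c * z)) \<longlongrightarrow> (1 - (a - b) * z) * L - b * z * L') F"
  proof (rule Lim_transform_eventually)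
    show "eventually (\<lambda>c. - ((2 * b * inverse c - 1 + (a - b) * z) * hyp2F1 a b c (c * z)
      + b * (z - inverse c) * hyp2F1 a (b + 1) c (c * z)) / (1 - b * inverse c) = hyp2F1 a (b - 1) c (c * z)) F"
      using ev evs
    proof eventually_elim
      case (elim c)
      then have "hyp2F1 a (b - 1) c (c * z) = - ((2 * b - c + (a - b) * (c * z)) * hyp2F1 a b c (c * z)
          + b * (c * z - 1) * hyp2F1 a (b + 1) c (c * z)) / (c - b)"
        by (intro hyp2F1_minus_1) auto
      also have "c - b = c * (1 - b * inverse c)" using elim by (simp add: field_simps)
      also have "- ((2 * b - c + (a - b) * (c * z)) * hyp2F1 a b c (c * z)
          + b * (c * z - 1) * hyp2F1 a (b + 1) c (c * z)) =
          c * - ((2 * b * inverse c - 1 + (a - b) * z) * hyp2F1 a b c (c * z)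
          + b * (z - inverse c) * hyp2F1 a (b + 1) c (c * z))"
        using elim by (simp add: field_simps)
      finally show ?case using elim by simp
    qed
  qed
qed

text \<open>The half-plane is enlarged by one unit at a time: for b in the new strip, b + 1 and b +
  2 already lie in the previous half-plane, as a three-term relation requires.\<close>

lemma complex_downward_induct:
  assumes base: "\<And>b. Re b \<ge> M \<Longrightarrow> P b" and step: "\<And>b. P b \<Longrightarrow> P (b + 1) \<Longrightarrow> P (b - 1)"
  shows "P b"
proof -
  have "Re b \<ge> M - real n \<Longrightarrow> P b" for n b
  proof (induction n arbitrary: b)
    case (Suc n)
    have "P (b + 1)" "P (b + 1 + 1)" using Suc.prems by (auto intro!: Suc.IH)
    from step[OF this] show ?case by simp
  qed (simp add: base)
  moreover obtain n where "real n \<ge> M - Re b" using real_arch_simple by blast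
  ultimately show ?thesis by (smt (verit))
qed

lemma has_hyp2F0_base:
  assumes "Re a \<ge> 0" "Re b \<ge> 1" "- z \<notin> \<real>\<^sub>\<le>\<^sub>0"
  shows "has_hyp2F0 a b z (laplace_int a b 1 (- z) / Gamma b)"
  using eventually_has_hyp2F1_base[OF assms] hyp2F1_tendsto_base[OF assms]
  by (simp add: has_hyp2F0_def)

lemma has_hyp2F0_hyp2F0:
  assumes z: "- z \<notin> \<real>\<^sub>\<le>\<^sub>0"
  shows "has_hyp2F0 a b z (hyp2F0 a b z)"
proof -
  have z0: "z \<noteq> 0" using z by auto
  have step: "\<exists>L. has_hyp2F0 a (b - 1) z L"
    if "\<exists>L. has_hyp2F0 a b z L" "\<exists>L. has_hyp2F0 a (b + 1) z L" for a b
    using has_hyp2F0_minus_1[OF z0] that by blast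
  have half: "\<exists>L. has_hyp2F0 a b z L" if "Re a \<ge> 0" for a b
    by (rule complex_downward_induct[where M = 1])
       (use has_hyp2F0_base[OF that _ z] step in blast)+
  \<comment> \<open>With all second parameters reached for \<open>Re a \<ge> 0\<close>, symmetry
    gives every first parameter when \<open>Re b \<ge> 0\<close>; this is the base for lowering b
    once more.\<close>
  have "\<exists>L. has_hyp2F0 a b z L"
    by (rule complex_downward_induct[where M = 0 and P = "\<lambda>b. \<exists>L. has_hyp2F0 a b z L"])
       (use half[of _ a] step has_hyp2F0_swap in blast)+
  then show ?thesis using hyp2F0_eqI[OF z] by blast
qed

lemma hyp2F0_minus_1:
  assumes "- z \<notin> \<real>\<^sub>\<le>\<^sub>0"
  shows "hyp2F0 a (b - 1) z = (1 - (a - b) * z) * hyp2F0 a b z - b * z * hyp2F0 a (b + 1) z"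
  using assms by (intro hyp2F0_eqI has_hyp2F0_minus_1 has_hyp2F0_hyp2F0) auto

lemma hyp2F0_contiguous:
  assumes z: "- z \<notin> \<real>\<^sub>\<le>\<^sub>0"
  shows "(a - b) * hyp2F0 a b z = a * hyp2F0 (a + 1) b z - b * hyp2F0 a (b + 1) z"
proof -
  obtain \<epsilon> where \<epsilon>: "\<epsilon> > 0" "inf at_infinity (principal (hyp2F0_sector z \<epsilon>)) \<noteq> bot" (is "?F \<noteq> bot")
    using sector_filter_neq_bot[OF z] .
  have z0: "z \<noteq> 0" using z by auto
  have ev: "eventually (has_hyp2F1 a b) ?F" "eventually (has_hyp2F1 (a + 1) b) ?F"
      "eventually (has_hyp2F1 a (b + 1)) ?F"
    and lims: "((\<lambda>c. hyp2F1 a b c (c * z)) \<longlongrightarrow> hyp2F0 a b z) ?F"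
      "((\<lambda>c. hyp2F1 (a + 1) b c (c * z)) \<longlongrightarrow> hyp2F0 (a + 1) b z) ?F"
      "((\<lambda>c. hyp2F1 a (b + 1) c (c * z)) \<longlongrightarrow> hyp2F0 a (b + 1) z) ?F"
    using has_hyp2F0_hyp2F0[OF z] \<epsilon>(1) unfolding has_hyp2F0_def by blast+
  have evs: "eventually (\<lambda>c. c \<in> hyp2F0_sector z \<epsilon>) ?F"
    by (simp add: eventually_inf_principal)
  have "((\<lambda>c. a * hyp2F1 (a + 1) b c (c * z) - b * hyp2F1 a (b + 1) c (c * z)) \<longlongrightarrow>
      a * hyp2F0 (a + 1) b z - b * hyp2F0 a (b + 1) z) ?F"
    by (intro tendsto_intros lims)
  moreover have "eventually (\<lambda>c. a * hyp2F1 (a + 1) b c (c * z) - b * hyp2F1 a (b + 1) c (c * z)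
      = (a - b) * hyp2F1 a b c (c * z)) ?F"
    using ev evs
    by eventually_elim (use hyp2F1_contiguous mult_in_slit_plane[OF _ \<epsilon>(1) z0] in auto)
  ultimately have "((\<lambda>c. (a - b) * hyp2F1 a b c (c * z)) \<longlongrightarrow>
      a * hyp2F0 (a + 1) b z - b * hyp2F0 a (b + 1) z) ?F"
    by (rule Lim_transform_eventually)
  moreover have "((\<lambda>c. (a - b) * hyp2F1 a b c (c * z)) \<longlongrightarrow> (a - b) * hyp2F0 a b z) ?F"
    by (intro tendsto_intros lims)
  ultimately show ?thesis using \<epsilon>(2) tendsto_unique by blast
qed

lemma open_Compl_nonneg: "open {z::complex. - z \<notin> \<real>\<^sub>\<le>\<^sub>0}"
proof -
  have eq: "{z::complex. - z \<notin> \<real>\<^sub>\<le>\<^sub>0} = uminus -` (- \<real>\<^sub>\<le>\<^sub>0)" by auto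
  show ?thesis
    unfolding eq by (intro open_vimage open_Compl closed_nonpos_Reals_complex continuous_intros)
qed

section \<open>Differentiation in the variable\<close>

lemma has_field_derivative_hyp2F0:
  assumes "- z \<notin> \<real>\<^sub>\<le>\<^sub>0"
  shows "(hyp2F0 a b has_field_derivative a * (hyp2F0 (a + 1) b z - hyp2F0 a b z) / z) (at z)"
proof -
  define Q where "Q a b \<longleftrightarrow> (\<forall>z. - z \<notin> \<real>\<^sub>\<le>\<^sub>0 \<longrightarrow>
    (hyp2F0 a b has_field_derivative a * (hyp2F0 (a + 1) b z - hyp2F0 a b z) / z) (at z))" for a b
  have base: "Q a b" if ab: "Re a \<ge> 0" "Re b \<ge> 1" for a b
    unfolding Q_def
  proof (intro allI impI)
    fix z :: complex assume z: "- z \<notin> \<real>\<^sub>\<le>\<^sub>0"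
    have eq: "hyp2F0 a b z = laplace_int a b 1 (- z) / Gamma b"
      if "Re a \<ge> 0" "- z \<notin> \<real>\<^sub>\<le>\<^sub>0" for a z
      using hyp2F0_eqI has_hyp2F0_base that ab by blast
    have "((\<lambda>z. laplace_int a b 1 (- z)) has_field_derivative
        a * (laplace_int (a + 1) b 1 (- z) - laplace_int a b 1 (- z)) / (- z) * (- 1)) (at z)"
      using ab z by (intro DERIV_chain2[OF has_field_derivative_laplace_int_right]) (auto intro!: derivative_eq_intros)
    then have "((\<lambda>z. laplace_int a b 1 (- z) / Gamma b) has_field_derivative
        (a * (laplace_int (a + 1) b 1 (- z) - laplace_int a b 1 (- z)) / (- z) * (- 1)) / Gamma b) (at z)"
      by (rule DERIV_cdivide)
    then have "(hyp2F0 a b has_field_derivative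
        (a * (laplace_int (a + 1) b 1 (- z) - laplace_int a b 1 (- z)) / (- z) * (- 1)) / Gamma b) (at z)"
      by (rule has_field_derivative_transform_within_open[OF _ open_Compl_nonneg])
         (use z eq ab in auto)
    also have "(a * (laplace_int (a + 1) b 1 (- z) - laplace_int a b 1 (- z)) / (- z) * (- 1)) / Gamma b
        = a * (hyp2F0 (a + 1) b z - hyp2F0 a b z) / z"
      using eq[of "a + 1" z] eq[of a z] ab z by (simp add: diff_divide_distrib[symmetric])
    finally show "(hyp2F0 a b has_field_derivative a * (hyp2F0 (a + 1) b z - hyp2F0 a b z) / z) (at z)" .
  qed
  have step: "Q a (b - 1)" if Q: "Q a b" "Q a (b + 1)" for a b
    unfolding Q_def
  proof (intro allI impI)
    fix z :: complex assume z: "- z \<notin> \<real>\<^sub>\<le>\<^sub>0"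
    have z0: "z \<noteq> 0" using z by auto
    have Qz: "(hyp2F0 a b has_field_derivative a * (hyp2F0 (a + 1) b z - hyp2F0 a b z) / z) (at z)"
      "(hyp2F0 a (b + 1) has_field_derivative a * (hyp2F0 (a + 1) (b + 1) z - hyp2F0 a (b + 1) z) / z) (at z)"
      using Q z by (auto simp: Q_def)
    have "((\<lambda>z. (1 - (a - b) * z) * hyp2F0 a b z - b * z * hyp2F0 a (b + 1) z) has_field_derivative
        (1 - (a - b) * z) * (a * (hyp2F0 (a + 1) b z - hyp2F0 a b z) / z) + (- (a - b)) * hyp2F0 a b z
        - (b * z * (a * (hyp2F0 (a + 1) (b + 1) z - hyp2F0 a (b + 1) z) / z) + b * hyp2F0 a (b + 1) z)) (at z)"
      by (rule derivative_eq_intros Qz refl | simp)+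
    \<comment> \<open>The difference of the two sides is exactly the contiguous relation at (a,
      b).\<close>
    also have "(1 - (a - b) * z) * (a * (hyp2F0 (a + 1) b z - hyp2F0 a b z) / z) + (- (a - b)) * hyp2F0 a b z
        - (b * z * (a * (hyp2F0 (a + 1) (b + 1) z - hyp2F0 a (b + 1) z) / z) + b * hyp2F0 a (b + 1) z)
        = a * (hyp2F0 (a + 1) (b - 1) z - hyp2F0 a (b - 1) z) / z"
      unfolding hyp2F0_minus_1[OF z] using hyp2F0_contiguous[OF z, of a b] z0
      by (simp add: divide_simps) algebra
    finally show "(hyp2F0 a (b - 1) has_field_derivative
        a * (hyp2F0 (a + 1) (b - 1) z - hyp2F0 a (b - 1) z) / z) (at z)"
      by (rule has_field_derivative_transform_within_open[OF _ open_Compl_nonneg])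
         (use z hyp2F0_minus_1 in auto)
  qed
  \<comment> \<open>By the contiguous relation a (F(a+1,b) - F) = b (F(a,b+1) - F), so the
    derivative formula is symmetric in a and b.\<close>
  have swap: "Q a b" if Q: "Q b a" for a b
    unfolding Q_def
  proof (intro allI impI)
    fix z :: complex assume z: "- z \<notin> \<real>\<^sub>\<le>\<^sub>0"
    have "a * (hyp2F0 (a + 1) b z - hyp2F0 a b z) = b * (hyp2F0 (b + 1) a z - hyp2F0 b a z)"
      unfolding hyp2F0_swap[of "b + 1"] hyp2F0_swap[of b a] using hyp2F0_contiguous[OF z, of a b] by algebra
    moreover have "hyp2F0 a b = hyp2F0 b a" by (rule ext) (rule hyp2F0_swap)
    ultimately show "(hyp2F0 a b has_field_derivative a * (hyp2F0 (a + 1) b z - hyp2F0 a b z) / z) (at z)"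
      using Q z by (simp add: Q_def)
  qed
  have Q1: "Q a b" if "Re a \<ge> 0" for a b
    by (rule complex_downward_induct[where M = 1]) (use base that step in blast)+
  have "Q a b"
    by (rule complex_downward_induct[where M = 0 and P = "Q a"]) (use Q1 swap step in blast)+
  then show ?thesis using assms by (simp add: Q_def)
qed

section \<open>The functions \<open>hermite_S\<close>\<close>

text \<open>If w^2 were real and nonpositive, Re w Im w = 0 would force Im w = 0 and then w^2 > 0.
  So the argument -w^(-2) lies in the domain of \<open>hyp2F0\<close>.\<close>

lemma inverse_square_notin_nonpos_Reals:
  fixes w :: complex
  assumes "Re w > 0"
  shows "w powi - 2 \<notin> \<real>\<^sub>\<le>\<^sub>0"
proof
  assume "w powi - 2 \<in> \<real>\<^sub>\<le>\<^sub>0"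
  then have "inverse (w powi - 2) \<in> \<real>\<^sub>\<le>\<^sub>0" by simp
  moreover have "inverse (w powi - 2) = w\<^sup>2" by (simp add: power_int_minus)
  ultimately have "w\<^sup>2 \<in> \<real>\<^sub>\<le>\<^sub>0" by simp
  then have "Re w * Im w = 0" "(Re w)\<^sup>2 \<le> (Im w)\<^sup>2"
    by (auto simp: complex_nonpos_Reals_iff power2_eq_square)
  then show False using assms by auto
qed

text \<open>Raising l by 1 turns the parameters (a, b) into (b, a + 1), the symmetry restoring the
  order. For z = -w^(-2) one has z'/z = -2/w, and the prefactor is w^(-2a); the two terms with F(a,
  b) cancel and -2a w^(-2a-1) F(a+1, b) remains.\<close>

lemma has_field_derivative_hermite_S:
  assumes w: "Re w > 0"
  shows "(hermite_S l has_field_derivative - (1 / 2 + l) * hermite_S (l + 1) w) (at w)"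
proof -
  define a where "a = l / 2 + 1 / 4"
  define b where "b = l / 2 + 3 / 4"
  define z where "z = - (w powi - 2)"
  have w0: "w \<noteq> 0" and wn: "w \<notin> \<real>\<^sub>\<le>\<^sub>0" using w by (auto simp: complex_nonpos_Reals_iff)
  have z: "- z \<notin> \<real>\<^sub>\<le>\<^sub>0" using inverse_square_notin_nonpos_Reals[OF w] by (simp add: z_def)
  have zw: "z = - 1 / w\<^sup>2" by (simp add: z_def power_int_minus divide_inverse)
  define P where "P = w powr (- l - 1 / 2)"
  have P: "w powr (- l - 1 / 2 - 1) = P / w" "w powr (- (l + 1) - 1 / 2) = P / w"
    using w0 powr_diff[of w "- l - 1 / 2" 1] by (auto simp: P_def algebra_simps)
  have "((\<lambda>w. - (w powi - 2)) has_field_derivative 2 / w ^ 3) (at w)"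
  proof -
    have "((\<lambda>w. - (w powi - 2)) has_field_derivative - (of_int (- 2) * w powi (- 2 - 1) * 1)) (at w)"
      by (rule derivative_intros | use w0 in simp)+
    also have "- (of_int (- 2) * w powi (- 2 - 1) * 1) = 2 / w ^ 3"
      by (simp add: power_int_minus divide_inverse)
    finally show ?thesis .
  qed
  then have "((\<lambda>w. hyp2F0 a b (- (w powi - 2))) has_field_derivative
      (a * (hyp2F0 (a + 1) b z - hyp2F0 a b z) / z) * (2 / w ^ 3)) (at w)"
    by (rule DERIV_chain2[where f = "hyp2F0 a b" and g = "\<lambda>w. - (w powi - 2)",
          OF has_field_derivative_hyp2F0[OF z, unfolded z_def], folded z_def])
  from DERIV_mult[OF has_field_derivative_powr[OF wn, of "- l - 1 / 2"] this]
  have "(hermite_S l has_field_derivative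
      (- l - 1 / 2) * (P / w) * hyp2F0 a b z
      + (a * (hyp2F0 (a + 1) b z - hyp2F0 a b z) / z) * (2 / w ^ 3) * P) (at w)"
    unfolding hermite_S_def[abs_def] a_def[symmetric] b_def[symmetric] z_def[symmetric] P P_def[symmetric] .
  also have "(- l - 1 / 2) * (P / w) * hyp2F0 a b z
      + (a * (hyp2F0 (a + 1) b z - hyp2F0 a b z) / z) * (2 / w ^ 3) * P
      = - (2 * a) * (P / w * hyp2F0 b (a + 1) z)"
    using w0 unfolding zw hyp2F0_swap[of b]
    by (simp add: a_def divide_simps power2_eq_square power3_eq_cube) (simp add: algebra_simps)
  also have "\<dots> = - (1 / 2 + l) * hermite_S (l + 1) w"
    unfolding hermite_S_def P z_def[symmetric] by (simp add: a_def b_def add_divide_distrib add_ac distrib_left)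
  finally show ?thesis .
qed

text \<open>Lowering l by 1 gives the parameters (b - 1, a). The two contiguous relations combine to
  F(a, b-1) = F(a, b) - a z F(a+1, b), where z = -1/w^2 and a = (1/2 + l)/2.\<close>

lemma hermite_S_recurrence:
  assumes w: "Re w > 0"
  shows "w * hermite_S l w = hermite_S (l - 1) w - (1 / 2 + l) / 2 * hermite_S (l + 1) w"
proof -
  define a where "a = l / 2 + 1 / 4"
  define b where "b = l / 2 + 3 / 4"
  define z where "z = - (w powi - 2)"
  define P where "P = w powr (- l - 1 / 2)"
  have w0: "w \<noteq> 0" using w by auto
  have z: "- z \<notin> \<real>\<^sub>\<le>\<^sub>0" using inverse_square_notin_nonpos_Reals[OF w] by (simp add: z_def)
  have zw: "z = - 1 / w\<^sup>2" by (simp add: z_def power_int_minus divide_inverse)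
  have P: "w powr (- (l - 1) - 1 / 2) = P * w" "w powr (- (l + 1) - 1 / 2) = P / w"
    using w0 powr_diff[of w "- l - 1 / 2" 1] powr_add[of w "- l - 1 / 2" 1]
    by (auto simp: P_def algebra_simps)
  have S: "hermite_S l w = P * hyp2F0 a b z"
    by (simp add: hermite_S_def a_def b_def z_def P_def)
  have "(l - 1) / 2 + 1 / 4 = b - 1" "(l - 1) / 2 + 3 / 4 = a"
    "(l + 1) / 2 + 1 / 4 = b" "(l + 1) / 2 + 3 / 4 = a + 1"
    by (simp_all add: a_def b_def field_simps)
  then have S': "hermite_S (l - 1) w = P * w * hyp2F0 a (b - 1) z"
    "hermite_S (l + 1) w = P / w * hyp2F0 (a + 1) b z"
    by (simp_all add: hermite_S_def P z_def hyp2F0_swap[of b] hyp2F0_swap[of "b - 1"] del: minus_diff_eq minus_add_distrib)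
  have "hyp2F0 a (b - 1) z = hyp2F0 a b z - a * z * hyp2F0 (a + 1) b z"
    unfolding hyp2F0_minus_1[OF z] using hyp2F0_contiguous[OF z, of a b] by algebra
  moreover have "(1 / 2 + l) / 2 = a" by (simp add: a_def field_simps)
  ultimately show ?thesis
    unfolding S S' zw using w0 by (simp add: field_simps power2_eq_square)
qed

text \<open>Differentiability belongs to the conclusion because \<open>deriv\<close> is total:
  equations for it alone would not say that it is a derivative.\<close>

theorem mainTheorem5:
  fixes l w :: complex
  assumes "Re w > 0"
  shows "hermite_S l field_differentiable (at w) \<and>
    deriv (hermite_S l) w = - (1 / 2 + l) * hermite_S (l + 1) w \<and>
    deriv (hermite_S l) w - 2 * w * hermite_S l w = - 2 * hermite_S (l - 1) w \<and>
    w * deriv (hermite_S l) w + (1 / 2 + l) * hermite_S l w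
      = 1 / 2 * (1 / 2 + l) * (3 / 2 + l) * hermite_S (l + 2) w \<and>
    w * deriv (hermite_S l) w + (1 / 2 - l - 2 * w\<^sup>2) * hermite_S l w
      = - 2 * hermite_S (l - 2) w"
proof -
  note D = has_field_derivative_hermite_S[OF assms, of l]
  have d: "deriv (hermite_S l) w = - (1 / 2 + l) * hermite_S (l + 1) w"
    by (rule DERIV_imp_deriv[OF D])
  \<comment> \<open>The recurrence at l, l + 1 and l - 1. The first replaces S at l + 1 by S at l -
    1 in the derivative; the others remove the factor w from S at l + 1 and at l - 1, producing S at
    l + 2 and at l - 2.\<close>
  have r0: "w * hermite_S l w = hermite_S (l - 1) w - (1 / 2 + l) / 2 * hermite_S (l + 1) w"
    by (rule hermite_S_recurrence[OF assms])
  have r1: "w * hermite_S (l + 1) w = hermite_S l w - (3 / 2 + l) / 2 * hermite_S (l + 2) w"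
    using hermite_S_recurrence[OF assms, of "l + 1"] by (simp add: algebra_simps)
  have r2: "w * hermite_S (l - 1) w = hermite_S (l - 2) w - (l - 1 / 2) / 2 * hermite_S l w"
    using hermite_S_recurrence[OF assms, of "l - 1"] by (simp add: algebra_simps)
  show ?thesis
  proof (intro conjI)
    show "hermite_S l field_differentiable (at w)" using D by (auto simp: field_differentiable_def)
    show "deriv (hermite_S l) w = - (1 / 2 + l) * hermite_S (l + 1) w" by (rule d)
    show 2: "deriv (hermite_S l) w - 2 * w * hermite_S l w = - 2 * hermite_S (l - 1) w"
      unfolding d using r0 by (simp add: field_simps)
    show "w * deriv (hermite_S l) w + (1 / 2 + l) * hermite_S l w
      = 1 / 2 * (1 / 2 + l) * (3 / 2 + l) * hermite_S (l + 2) w"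
    proof -
      have "w * deriv (hermite_S l) w = - (1 / 2 + l) * (w * hermite_S (l + 1) w)"
        unfolding d by (simp add: mult_ac)
      then have eq: "w * deriv (hermite_S l) w
          = - (1 / 2 + l) * (hermite_S l w - (3 / 2 + l) / 2 * hermite_S (l + 2) w)"
        unfolding r1 .
      show ?thesis unfolding eq by (simp add: field_simps)
    qed
    show "w * deriv (hermite_S l) w + (1 / 2 - l - 2 * w\<^sup>2) * hermite_S l w = - 2 * hermite_S (l - 2) w"
    proof -
      have "deriv (hermite_S l) w = 2 * w * hermite_S l w - 2 * hermite_S (l - 1) w"
        using 2 by (simp add: algebra_simps)
      then have eq: "w * deriv (hermite_S l) w = 2 * w\<^sup>2 * hermite_S l w - 2 * (w * hermite_S (l - 1) w)"
        by algebra
      show ?thesis unfolding eq r2 by (simp add: field_simps)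
    qed
  qed
qed

end
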